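(* The universal cover of a connected Weyl graph of type $M$ is a building of type $M$; and the image of a building under a covering is a connected Weyl graph, i.e. if $p:\Delta\to\mathcal W$ is a covering of Weyl data of type $M$ and $\Delta$ is a building, then $\mathcal W$ is a connected Weyl graph.
   Context: Setting. $M=(m_{st})_{s,t\in S}$ is a Coxeter matrix on a finite set $S$, and $W=\langle S\mid (st)^{m_{st}}=1,\ m_{st}<\infty\rangle$ is its Coxeter group. A word over $S$ is reduced if no shorter word represents the same element of $W$. For $s\ne t$ let $p_m(s,t)=stst\cdots$ ($m$ letters), and if $m_{st}<\infty$ let $p(s,t)=p_{m_{st}}(s,t)$. Groupoids are small and non-empty, with composition $g;h$ (or $gh$) written left to right, defined when $\tau(g)=\iota(h)$, where $\iota,\tau$ denote initial and terminal vertices. Weyl data. A generalized chamber system $\mathcal W$ of type $M$ is a set $\mathcal W_0$ of chambers with a family of groupoids $(\mathcal W_s)_{s\in S}$ (panel groupoids), each with vertex set $\mathcal W_0$. An edge of $\mathcal W$ of type $s$ is a non-identity edge of $\mathcal W_s$ (edges of different types are distinct). An $s$-panel is a connected component of $\mathcal W_s$. A gallery $\beta$ is a finite sequence of consecutive edges (a trivial gallery is a single chamber with no edges), with initial chamber $\iota(\beta)$, terminal chamber $\tau(\beta)$, type $\beta_S$ (the word of types of its edges), and $W$-length $\beta_W\in W$ (the element represented by $\beta_S$). It is a cycle if $\iota(\beta)=\tau(\beta)$, and a geodesic if $\beta_S$ is reduced. For $s\neq t$ with $m_{st}<\infty$: a maximal $(s,t)$-geodesic is a gallery of type $p(s,t)$;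 an $(s,t)$-cycle is a cycle of type $p_{2m_{st}}(s,t)$. Weyl data of type $M$ is a generalized chamber system of type $M$ together with, for each ordered pair $(s,t)$ with $s\neq t$, $m_{st}<\infty$, a set of $(s,t)$-cycles called defining suites. It is connected if any two chambers are joined by a gallery. Homotopy. Elementary homotopies of galleries are the following moves on subgalleries and their inverses: delete $i\,i^{-1}$; replace $i\,i'$ ($i,i'$ of the same type, $i'\ne i^{-1}$) by the single edge $i;i'$; delete a defining suite. Galleries are homotopic ($\sim$) if related by finitely many such moves. A suite is an $(s,t)$-cycle homotopic to a trivial gallery. The fundamental groupoid $\overline{\mathcal W}$ has vertices the chambers and edges the homotopy classes $[\beta]$ of galleries, with $[\beta];[\beta']=[\beta\beta']$. $\mathcal W$ is simply connected if $\overline{\mathcal W}$ has at most one edge from $C$ to $D$ for all chambers $C,D$. Morphisms and coverings. A morphism of generalized chamber systems of type $M$ is a map on chambers and edges preserving extremities, types and inverses, with $\omega(i;i')=\omega(i);\omega(i')$ whenever $i,i'$ are composable of the same type and $i'\neq i^{-1}$. A morphism of Weyl data is such a morphism sending defining suites to suites. A morphism is surjective-étale if it is surjective on chambers and, for every chamber $C$, restricts to a bijection from the edges issuing from $C$ to the edges issuing from the image of $C$. A covering $p:\widetilde{\mathcal W}\to\mathcal W$ of Weyl data is a surjective-étale morphism of Weyl data such that every gallery $\beta$ of $\widetilde{\mathcal W}$ with $p\circ\beta$ a defining suite of $\mathcal W$ is a suite of $\widetilde{\mathcal W}$. It is connected if $\widetilde{\mathcal W}$ is connected. A connected covering $p:\widetilde{\mathcal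 W}\to\mathcal W$ is a universal cover if for every connected covering $p':\widetilde{\mathcal W}'\to\mathcal W$ there is a morphism of Weyl data $\mu:\widetilde{\mathcal W}\to\widetilde{\mathcal W}'$ with $p=p'\circ\mu$ (every connected Weyl graph has one, unique up to isomorphism). A pre-Weyl graph is Weyl data satisfying (PW0) no panel is a trivial groupoid (one vertex, one edge), and (PW1) each maximal $(s,t)$-geodesic is homotopic to a maximal $(t,s)$-geodesic. A Weyl graph is a pre-Weyl graph satisfying (W) homotopic geodesics have the same $W$-length. A building is a Weyl graph that is connected and simply connected. *)

theory Defs
  imports Main "HOL-Library.Extended_Nat"
begin

section \<open>Coxeter matrices and Coxeter groups\<close>

record 's coxeter =
  gens :: "'s set"
  mat :: "'s \<Rightarrow> 's \<Rightarrow> enat"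

definition coxeter_matrix :: "'s coxeter \<Rightarrow> bool" where
  "coxeter_matrix M \<longleftrightarrow>
     finite (gens M) \<and>
     (\<forall>s\<in>gens M. mat M s s = 1) \<and>
     (\<forall>s\<in>gens M. \<forall>t\<in>gens M. s \<noteq> t \<longrightarrow> 2 \<le> mat M s t \<and> mat M s t = mat M t s)"

text \<open>
  The group presented by generators \<open>X\<close> and relators \<open>R\<close>. The pair \<open>(x, True)\<close> stands for the
  generator \<open>x\<close> and \<open>(x, False)\<close> for its formal inverse; group elements are the classes of such
  signed words under the congruence generated by cancellation and by the relators.
\<close>

inductive presentation_step :: "'a set \<Rightarrow> ('a \<times> bool) list set \<Rightarrow> ('a \<times> bool) list \<Rightarrow> ('a \<times> bool) list \<Rightarrow> bool"
  for X R where
  cancel: "\<lbrakk>u \<in> lists (X \<times> UNIV); v \<in> lists (X \<times> UNIV); x \<in> X\<rbrakk>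
             \<Longrightarrow> presentation_step X R (u @ [(x, b), (x, \<not> b)] @ v) (u @ v)"
| relator: "\<lbrakk>u \<in> lists (X \<times> UNIV); v \<in> lists (X \<times> UNIV); r \<in> R\<rbrakk>
             \<Longrightarrow> presentation_step X R (u @ r @ v) (u @ v)"

definition coxeter_relators :: "'s coxeter \<Rightarrow> ('s \<times> bool) list set" where
  "coxeter_relators M =
     {concat (replicate n [(s, True), (t, True)]) | s t n. s \<in> gens M \<and> t \<in> gens M \<and> mat M s t = enat n}"

definition represented :: "'s coxeter \<Rightarrow> 's list \<Rightarrow> ('s \<times> bool) list set" where
  "represented M w =
     {v. equivclp (presentation_step (gens M) (coxeter_relators M)) (map (\<lambda>s. (s, True)) w) v}"

definition reduced :: "'s coxeter \<Rightarrow> 's list \<Rightarrow> bool" where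
  "reduced M w \<longleftrightarrow>
     w \<in> lists (gens M) \<and>
     (\<forall>v\<in>lists (gens M). represented M v = represented M w \<longrightarrow> length w \<le> length v)"

fun alternating :: "nat \<Rightarrow> 's \<Rightarrow> 's \<Rightarrow> 's list" where
  "alternating 0 s t = []"
| "alternating (Suc n) s t = s # alternating n t s"

definition spherical_pair :: "'s coxeter \<Rightarrow> 's \<Rightarrow> 's \<Rightarrow> bool" where
  "spherical_pair M s t \<longleftrightarrow> s \<in> gens M \<and> t \<in> gens M \<and> s \<noteq> t \<and> mat M s t \<noteq> \<infinity>"


section \<open>Groupoids\<close>

text \<open>Composition is written left to right: \<open>gcomp G g h\<close> is defined when \<open>tgt G g = src G h\<close>.\<close>

record ('v, 'a) groupoid =
  verts :: "'v set"
  arrs :: "'a set"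
  src :: "'a \<Rightarrow> 'v"
  tgt :: "'a \<Rightarrow> 'v"
  ident :: "'v \<Rightarrow> 'a"
  gcomp :: "'a \<Rightarrow> 'a \<Rightarrow> 'a"
  ginv :: "'a \<Rightarrow> 'a"

locale groupoid =
  fixes G :: "('v, 'a) groupoid"
  assumes verts_nonempty: "verts G \<noteq> {}"
    and src_closed: "g \<in> arrs G \<Longrightarrow> src G g \<in> verts G"
    and tgt_closed: "g \<in> arrs G \<Longrightarrow> tgt G g \<in> verts G"
    and ident_closed: "v \<in> verts G \<Longrightarrow> ident G v \<in> arrs G"
    and src_ident: "v \<in> verts G \<Longrightarrow> src G (ident G v) = v"
    and tgt_ident: "v \<in> verts G \<Longrightarrow> tgt G (ident G v) = v"
    and comp_closed: "\<lbrakk>g \<in> arrs G; h \<in> arrs G; tgt G g = src G h\<rbrakk> \<Longrightarrow> gcomp G g h \<in> arrs G"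
    and src_comp: "\<lbrakk>g \<in> arrs G; h \<in> arrs G; tgt G g = src G h\<rbrakk> \<Longrightarrow> src G (gcomp G g h) = src G g"
    and tgt_comp: "\<lbrakk>g \<in> arrs G; h \<in> arrs G; tgt G g = src G h\<rbrakk> \<Longrightarrow> tgt G (gcomp G g h) = tgt G h"
    and comp_assoc: "\<lbrakk>g \<in> arrs G; h \<in> arrs G; k \<in> arrs G; tgt G g = src G h; tgt G h = src G k\<rbrakk>
                       \<Longrightarrow> gcomp G (gcomp G g h) k = gcomp G g (gcomp G h k)"
    and ident_comp: "g \<in> arrs G \<Longrightarrow> gcomp G (ident G (src G g)) g = g"
    and comp_ident: "g \<in> arrs G \<Longrightarrow> gcomp G g (ident G (tgt G g)) = g"
    and inver_closed: "g \<in> arrs G \<Longrightarrow> ginv G g \<in> arrs G"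
    and src_inver: "g \<in> arrs G \<Longrightarrow> src G (ginv G g) = tgt G g"
    and tgt_inver: "g \<in> arrs G \<Longrightarrow> tgt G (ginv G g) = src G g"
    and comp_inver: "g \<in> arrs G \<Longrightarrow> gcomp G g (ginv G g) = ident G (src G g)"
    and inver_comp: "g \<in> arrs G \<Longrightarrow> gcomp G (ginv G g) g = ident G (tgt G g)"

definition component :: "('v, 'a) groupoid \<Rightarrow> 'v \<Rightarrow> ('v, 'a) groupoid" where
  "component G v =
     (let K = {w. \<exists>g\<in>arrs G. src G g = v \<and> tgt G g = w}
      in G\<lparr>verts := K, arrs := {g \<in> arrs G. src G g \<in> K}\<rparr>)"

definition trivial_groupoid :: "('v, 'a) groupoid \<Rightarrow> bool" where
  "trivial_groupoid G \<longleftrightarrow> (\<exists>v. verts G = {v}) \<and> (\<exists>g. arrs G = {g})"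


section \<open>Generalized chamber systems, galleries and Weyl data\<close>

text \<open>An edge is a pair of its type and a non-identity arrow of the panel groupoid of that type,
  so that edges of different types are distinct.  A gallery is its initial chamber together with
  its list of edges.\<close>

type_synonym ('s, 'e) edge = "'s \<times> 'e"
type_synonym ('s, 'c, 'e) gallery = "'c \<times> ('s, 'e) edge list"

record ('s, 'c, 'e) chamber_system =
  chambers :: "'c set"
  panel_groupoid :: "'s \<Rightarrow> ('c, 'e) groupoid"

record ('s, 'c, 'e) weyl_data = "('s, 'c, 'e) chamber_system" +
  defining_suites :: "'s \<Rightarrow> 's \<Rightarrow> ('s, 'c, 'e) gallery set"

definition chamber_system :: "'s coxeter \<Rightarrow> ('s, 'c, 'e, 'z) chamber_system_scheme \<Rightarrow> bool" where
  "chamber_system M X \<longleftrightarrow>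
     chambers X \<noteq> {} \<and>
     (\<forall>s\<in>gens M. groupoid (panel_groupoid X s) \<and> verts (panel_groupoid X s) = chambers X)"

definition edges :: "'s coxeter \<Rightarrow> ('s, 'c, 'e, 'z) chamber_system_scheme \<Rightarrow> ('s, 'e) edge set" where
  "edges M X =
     {(s, e). s \<in> gens M \<and> e \<in> arrs (panel_groupoid X s) \<and>
              (\<forall>C\<in>chambers X. e \<noteq> ident (panel_groupoid X s) C)}"

definition edge_src :: "('s, 'c, 'e, 'z) chamber_system_scheme \<Rightarrow> ('s, 'e) edge \<Rightarrow> 'c" where
  "edge_src X i = src (panel_groupoid X (fst i)) (snd i)"

definition edge_tgt :: "('s, 'c, 'e, 'z) chamber_system_scheme \<Rightarrow> ('s, 'e) edge \<Rightarrow> 'c" where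
  "edge_tgt X i = tgt (panel_groupoid X (fst i)) (snd i)"

definition edge_inv :: "('s, 'c, 'e, 'z) chamber_system_scheme \<Rightarrow> ('s, 'e) edge \<Rightarrow> ('s, 'e) edge" where
  "edge_inv X i = (fst i, ginv (panel_groupoid X (fst i)) (snd i))"

text \<open>Meaningful only for edges of the same type; it is an edge again unless the edges are
  mutually inverse.\<close>

definition edge_comp ::
  "('s, 'c, 'e, 'z) chamber_system_scheme \<Rightarrow> ('s, 'e) edge \<Rightarrow> ('s, 'e) edge \<Rightarrow> ('s, 'e) edge" where
  "edge_comp X i j = (fst i, gcomp (panel_groupoid X (fst i)) (snd i) (snd j))"

definition panels :: "'s coxeter \<Rightarrow> ('s, 'c, 'e, 'z) chamber_system_scheme \<Rightarrow> ('c, 'e) groupoid set" where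
  "panels M X = {component (panel_groupoid X s) C | s C. s \<in> gens M \<and> C \<in> chambers X}"

fun gallery_from ::
  "'s coxeter \<Rightarrow> ('s, 'c, 'e, 'z) chamber_system_scheme \<Rightarrow> 'c \<Rightarrow> ('s, 'e) edge list \<Rightarrow> bool" where
  "gallery_from M X C [] \<longleftrightarrow> C \<in> chambers X"
| "gallery_from M X C (i # es) \<longleftrightarrow>
     i \<in> edges M X \<and> edge_src X i = C \<and> gallery_from M X (edge_tgt X i) es"

definition gallery :: "'s coxeter \<Rightarrow> ('s, 'c, 'e, 'z) chamber_system_scheme \<Rightarrow> ('s, 'c, 'e) gallery \<Rightarrow> bool" where
  "gallery M X \<beta> \<longleftrightarrow> gallery_from M X (fst \<beta>) (snd \<beta>)"

definition initial :: "('s, 'c, 'e) gallery \<Rightarrow> 'c" where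
  "initial \<beta> = fst \<beta>"

definition terminal :: "('s, 'c, 'e, 'z) chamber_system_scheme \<Rightarrow> ('s, 'c, 'e) gallery \<Rightarrow> 'c" where
  "terminal X \<beta> = (if snd \<beta> = [] then fst \<beta> else edge_tgt X (last (snd \<beta>)))"

definition gtype :: "('s, 'c, 'e) gallery \<Rightarrow> 's list" where
  "gtype \<beta> = map fst (snd \<beta>)"

definition W_length :: "'s coxeter \<Rightarrow> ('s, 'c, 'e) gallery \<Rightarrow> ('s \<times> bool) list set" where
  "W_length M \<beta> = represented M (gtype \<beta>)"

definition trivial_gallery :: "'c \<Rightarrow> ('s, 'c, 'e) gallery" where
  "trivial_gallery C = (C, [])"

definition append_gallery ::
  "('s, 'c, 'e) gallery \<Rightarrow> ('s, 'c, 'e) gallery \<Rightarrow> ('s, 'c, 'e) gallery" where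
  "append_gallery \<beta> \<gamma> = (fst \<beta>, snd \<beta> @ snd \<gamma>)"

definition reverse_gallery ::
  "('s, 'c, 'e, 'z) chamber_system_scheme \<Rightarrow> ('s, 'c, 'e) gallery \<Rightarrow> ('s, 'c, 'e) gallery" where
  "reverse_gallery X \<beta> = (terminal X \<beta>, rev (map (edge_inv X) (snd \<beta>)))"

definition geodesic :: "'s coxeter \<Rightarrow> ('s, 'c, 'e, 'z) chamber_system_scheme \<Rightarrow> ('s, 'c, 'e) gallery \<Rightarrow> bool" where
  "geodesic M X \<beta> \<longleftrightarrow> gallery M X \<beta> \<and> reduced M (gtype \<beta>)"

definition maximal_geodesic ::
  "'s coxeter \<Rightarrow> ('s, 'c, 'e, 'z) chamber_system_scheme \<Rightarrow> 's \<Rightarrow> 's \<Rightarrow> ('s, 'c, 'e) gallery \<Rightarrow> bool" where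
  "maximal_geodesic M X s t \<beta> \<longleftrightarrow>
     gallery M X \<beta> \<and> gtype \<beta> = alternating (the_enat (mat M s t)) s t"

definition st_cycle ::
  "'s coxeter \<Rightarrow> ('s, 'c, 'e, 'z) chamber_system_scheme \<Rightarrow> 's \<Rightarrow> 's \<Rightarrow> ('s, 'c, 'e) gallery \<Rightarrow> bool" where
  "st_cycle M X s t \<beta> \<longleftrightarrow>
     gallery M X \<beta> \<and> initial \<beta> = terminal X \<beta> \<and>
     gtype \<beta> = alternating (2 * the_enat (mat M s t)) s t"

definition weyl_data :: "'s coxeter \<Rightarrow> ('s, 'c, 'e) weyl_data \<Rightarrow> bool" where
  "weyl_data M X \<longleftrightarrow>
     chamber_system M X \<and>
     (\<forall>s t. spherical_pair M s t \<longrightarrow> (\<forall>\<beta>\<in>defining_suites X s t. st_cycle M X s t \<beta>))"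

definition connected_system :: "'s coxeter \<Rightarrow> ('s, 'c, 'e, 'z) chamber_system_scheme \<Rightarrow> bool" where
  "connected_system M X \<longleftrightarrow>
     (\<forall>C\<in>chambers X. \<forall>D\<in>chambers X. \<exists>\<beta>. gallery M X \<beta> \<and> initial \<beta> = C \<and> terminal X \<beta> = D)"


section \<open>Homotopy and the fundamental groupoid\<close>

inductive elementary_homotopy ::
  "'s coxeter \<Rightarrow> ('s, 'c, 'e) weyl_data \<Rightarrow> ('s, 'c, 'e) gallery \<Rightarrow> ('s, 'c, 'e) gallery \<Rightarrow> bool"
  for M X where
  delete_inverse:
    "gallery M X (C, us @ [i, edge_inv X i] @ vs)
       \<Longrightarrow> elementary_homotopy M X (C, us @ [i, edge_inv X i] @ vs) (C, us @ vs)"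
| compose:
    "\<lbrakk>gallery M X (C, us @ [i, j] @ vs); fst i = fst j; j \<noteq> edge_inv X i\<rbrakk>
       \<Longrightarrow> elementary_homotopy M X (C, us @ [i, j] @ vs) (C, us @ [edge_comp X i j] @ vs)"
| delete_suite:
    "\<lbrakk>gallery M X (C, us @ es @ vs); spherical_pair M s t; (D, es) \<in> defining_suites X s t\<rbrakk>
       \<Longrightarrow> elementary_homotopy M X (C, us @ es @ vs) (C, us @ vs)"

definition homotopic ::
  "'s coxeter \<Rightarrow> ('s, 'c, 'e) weyl_data \<Rightarrow> ('s, 'c, 'e) gallery \<Rightarrow> ('s, 'c, 'e) gallery \<Rightarrow> bool" where
  "homotopic M X \<beta> \<gamma> \<longleftrightarrow>
     gallery M X \<beta> \<and> gallery M X \<gamma> \<and> equivclp (elementary_homotopy M X) \<beta> \<gamma>"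

definition suite :: "'s coxeter \<Rightarrow> ('s, 'c, 'e) weyl_data \<Rightarrow> ('s, 'c, 'e) gallery \<Rightarrow> bool" where
  "suite M X \<beta> \<longleftrightarrow>
     (\<exists>s t. spherical_pair M s t \<and> st_cycle M X s t \<beta>) \<and>
     (\<exists>C\<in>chambers X. homotopic M X \<beta> (trivial_gallery C))"

definition fundamental_groupoid ::
  "'s coxeter \<Rightarrow> ('s, 'c, 'e) weyl_data \<Rightarrow> ('c, ('s, 'c, 'e) gallery set) groupoid" where
  "fundamental_groupoid M X =
     \<lparr>verts = chambers X,
      arrs = {\<beta>. gallery M X \<beta>} // {(\<beta>, \<gamma>). homotopic M X \<beta> \<gamma>},
      src = (\<lambda>a. the_elem (initial ` a)),
      tgt = (\<lambda>a. the_elem (terminal X ` a)),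
      ident = (\<lambda>C. {\<gamma>. homotopic M X (trivial_gallery C) \<gamma>}),
      gcomp = (\<lambda>a b. {\<gamma>. \<exists>\<beta>\<in>a. \<exists>\<beta>'\<in>b. homotopic M X (append_gallery \<beta> \<beta>') \<gamma>}),
      ginv = (\<lambda>a. {\<gamma>. \<exists>\<beta>\<in>a. homotopic M X (reverse_gallery X \<beta>) \<gamma>})\<rparr>"

definition simply_connected :: "'s coxeter \<Rightarrow> ('s, 'c, 'e) weyl_data \<Rightarrow> bool" where
  "simply_connected M X \<longleftrightarrow>
     (let \<Pi> = fundamental_groupoid M X in
      \<forall>C\<in>verts \<Pi>. \<forall>D\<in>verts \<Pi>. \<forall>a\<in>arrs \<Pi>. \<forall>b\<in>arrs \<Pi>.
        src \<Pi> a = C \<and> tgt \<Pi> a = D \<and> src \<Pi> b = C \<and> tgt \<Pi> b = D \<longrightarrow> a = b)"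


section \<open>Weyl graphs and buildings\<close>

definition pre_weyl_graph :: "'s coxeter \<Rightarrow> ('s, 'c, 'e) weyl_data \<Rightarrow> bool" where
  "pre_weyl_graph M X \<longleftrightarrow>
     weyl_data M X \<and>
     (\<forall>P\<in>panels M X. \<not> trivial_groupoid P) \<and>
     (\<forall>s t \<beta>. spherical_pair M s t \<and> maximal_geodesic M X s t \<beta> \<longrightarrow>
        (\<exists>\<gamma>. maximal_geodesic M X t s \<gamma> \<and> homotopic M X \<beta> \<gamma>))"

definition weyl_graph :: "'s coxeter \<Rightarrow> ('s, 'c, 'e) weyl_data \<Rightarrow> bool" where
  "weyl_graph M X \<longleftrightarrow>
     pre_weyl_graph M X \<and>
     (\<forall>\<beta> \<gamma>. geodesic M X \<beta> \<and> geodesic M X \<gamma> \<and> homotopic M X \<beta> \<gamma> \<longrightarrow> W_length M \<beta> = W_length M \<gamma>)"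

definition building :: "'s coxeter \<Rightarrow> ('s, 'c, 'e) weyl_data \<Rightarrow> bool" where
  "building M X \<longleftrightarrow> weyl_graph M X \<and> connected_system M X \<and> simply_connected M X"


section \<open>Morphisms and coverings\<close>

record ('s, 'c, 'e, 'd, 'f) morphism =
  on_chambers :: "'c \<Rightarrow> 'd"
  on_edges :: "('s, 'e) edge \<Rightarrow> ('s, 'f) edge"

definition image_gallery ::
  "('s, 'c, 'e, 'd, 'f) morphism \<Rightarrow> ('s, 'c, 'e) gallery \<Rightarrow> ('s, 'd, 'f) gallery" where
  "image_gallery \<omega> \<beta> = (on_chambers \<omega> (fst \<beta>), map (on_edges \<omega>) (snd \<beta>))"

definition chamber_system_morphism ::
  "'s coxeter \<Rightarrow> ('s, 'c, 'e, 'y) chamber_system_scheme \<Rightarrow> ('s, 'd, 'f, 'z) chamber_system_scheme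
     \<Rightarrow> ('s, 'c, 'e, 'd, 'f) morphism \<Rightarrow> bool" where
  "chamber_system_morphism M X Y \<omega> \<longleftrightarrow>
     (\<forall>C\<in>chambers X. on_chambers \<omega> C \<in> chambers Y) \<and>
     (\<forall>i\<in>edges M X.
        on_edges \<omega> i \<in> edges M Y \<and>
        fst (on_edges \<omega> i) = fst i \<and>
        edge_src Y (on_edges \<omega> i) = on_chambers \<omega> (edge_src X i) \<and>
        edge_tgt Y (on_edges \<omega> i) = on_chambers \<omega> (edge_tgt X i) \<and>
        on_edges \<omega> (edge_inv X i) = edge_inv Y (on_edges \<omega> i)) \<and>
     (\<forall>i\<in>edges M X. \<forall>j\<in>edges M X.
        fst i = fst j \<and> edge_tgt X i = edge_src X j \<and> j \<noteq> edge_inv X i \<longrightarrow>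
        on_edges \<omega> (edge_comp X i j) = edge_comp Y (on_edges \<omega> i) (on_edges \<omega> j))"

definition weyl_data_morphism ::
  "'s coxeter \<Rightarrow> ('s, 'c, 'e) weyl_data \<Rightarrow> ('s, 'd, 'f) weyl_data
     \<Rightarrow> ('s, 'c, 'e, 'd, 'f) morphism \<Rightarrow> bool" where
  "weyl_data_morphism M X Y \<omega> \<longleftrightarrow>
     chamber_system_morphism M X Y \<omega> \<and>
     (\<forall>s t. spherical_pair M s t \<longrightarrow>
        (\<forall>\<beta>\<in>defining_suites X s t. suite M Y (image_gallery \<omega> \<beta>)))"

definition surjective_etale ::
  "'s coxeter \<Rightarrow> ('s, 'c, 'e, 'y) chamber_system_scheme \<Rightarrow> ('s, 'd, 'f, 'z) chamber_system_scheme
     \<Rightarrow> ('s, 'c, 'e, 'd, 'f) morphism \<Rightarrow> bool" where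
  "surjective_etale M X Y \<omega> \<longleftrightarrow>
     on_chambers \<omega> ` chambers X = chambers Y \<and>
     (\<forall>C\<in>chambers X.
        bij_betw (on_edges \<omega>) {i \<in> edges M X. edge_src X i = C}
                              {j \<in> edges M Y. edge_src Y j = on_chambers \<omega> C})"

definition covering ::
  "'s coxeter \<Rightarrow> ('s, 'c, 'e) weyl_data \<Rightarrow> ('s, 'd, 'f) weyl_data
     \<Rightarrow> ('s, 'c, 'e, 'd, 'f) morphism \<Rightarrow> bool" where
  "covering M X Y p \<longleftrightarrow>
     weyl_data M X \<and> weyl_data M Y \<and>
     weyl_data_morphism M X Y p \<and>
     surjective_etale M X Y p \<and>
     (\<forall>s t \<beta>. spherical_pair M s t \<and> gallery M X \<beta> \<and> image_gallery p \<beta> \<in> defining_suites Y s t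
        \<longrightarrow> suite M X \<beta>)"

definition connected_covering ::
  "'s coxeter \<Rightarrow> ('s, 'c, 'e) weyl_data \<Rightarrow> ('s, 'd, 'f) weyl_data
     \<Rightarrow> ('s, 'c, 'e, 'd, 'f) morphism \<Rightarrow> bool" where
  "connected_covering M X Y p \<longleftrightarrow> covering M X Y p \<and> connected_system M X"

definition factors_through ::
  "'s coxeter \<Rightarrow> ('s, 'c, 'e) weyl_data \<Rightarrow> ('s, 'c, 'e, 'd, 'f) morphism
     \<Rightarrow> ('s, 'a, 'b) weyl_data \<Rightarrow> ('s, 'a, 'b, 'd, 'f) morphism \<Rightarrow> bool" where
  "factors_through M X p Z q \<longleftrightarrow>
     (\<exists>\<mu>. weyl_data_morphism M X Z \<mu> \<and>
          (\<forall>C\<in>chambers X. on_chambers p C = on_chambers q (on_chambers \<mu> C)) \<and>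
          (\<forall>i\<in>edges M X. on_edges p i = on_edges q (on_edges \<mu> i)))"

text \<open>
  A definition cannot quantify over the types of the competing coverings \<open>q : Z \<rightarrow> Y\<close>, so they
  range over one fixed pair of types in which every connected covering of \<open>Y\<close> has an isomorphic
  copy: fix \<open>C\<close> in \<open>Z\<close>, replace a chamber \<open>D\<close> of \<open>Z\<close> by the set of images in \<open>Y\<close> of the
  galleries from \<open>C\<close> to \<open>D\<close>, and an arrow by its source and its image in \<open>Y\<close>.  Lemma
  \<open>universal_cover_factors\<close> below proves that the universal property then holds with respect to
  connected coverings in arbitrary types.
\<close>

definition universal_cover ::
  "'s coxeter \<Rightarrow> ('s, 'c, 'e) weyl_data \<Rightarrow> ('s, 'd, 'f) weyl_data
     \<Rightarrow> ('s, 'c, 'e, 'd, 'f) morphism \<Rightarrow> bool" where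
  "universal_cover M X Y p \<longleftrightarrow>
     connected_covering M X Y p \<and>
     (\<forall>(Z :: ('s, ('s, 'd, 'f) gallery set, ('s, 'd, 'f) gallery set \<times> 'f) weyl_data) q.
        connected_covering M Z Y q \<longrightarrow> factors_through M X p Z q)"

section \<open>The universal property in arbitrary types\<close>

lemma gallery_from_edges: "gallery_from M X C es \<Longrightarrow> set es \<subseteq> edges M X"
  by (induction es arbitrary: C) auto

lemma edge_arr: "i \<in> edges M X \<Longrightarrow> snd i \<in> arrs (panel_groupoid X (fst i)) \<and> fst i \<in> gens M"
  by (auto simp: edges_def)

lemma edge_inv_edges:
  assumes X: "chamber_system M X" and i: "i \<in> edges M X"
  shows "edge_inv X i \<in> edges M X"
proof -
  obtain s e where [simp]: "i = (s, e)" by (cases i)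
  from i have s: "s \<in> gens M" and e: "e \<in> arrs (panel_groupoid X s)"
    and ni: "\<forall>C\<in>chambers X. e \<noteq> ident (panel_groupoid X s) C" by (auto simp: edges_def)
  interpret P: groupoid "panel_groupoid X s" using X s by (simp add: chamber_system_def)
  have v: "verts (panel_groupoid X s) = chambers X" using X s by (simp add: chamber_system_def)
  have "ginv (panel_groupoid X s) e \<noteq> ident (panel_groupoid X s) C" if C: "C \<in> chambers X" for C
  proof
    assume eq: "ginv (panel_groupoid X s) e = ident (panel_groupoid X s) C"
    then have t: "tgt (panel_groupoid X s) e = C"
      using P.src_inver[OF e] P.src_ident[of C] C v by simp
    have "e = gcomp (panel_groupoid X s) e (ginv (panel_groupoid X s) e)"
      using P.comp_ident[OF e] eq t by simp
    also have "\<dots> = ident (panel_groupoid X s) (src (panel_groupoid X s) e)"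
      by (rule P.comp_inver[OF e])
    finally show False using ni P.src_closed[OF e] v by auto
  qed
  then show ?thesis using s P.inver_closed[OF e] by (auto simp: edges_def edge_inv_def)
qed

lemma edge_tgt_chambers:
  assumes X: "chamber_system M X" and i: "i \<in> edges M X"
  shows "edge_tgt X i \<in> chambers X"
  using assms edge_arr[OF i] groupoid.tgt_closed[of "panel_groupoid X (fst i)" "snd i"]
  by (auto simp: chamber_system_def edge_tgt_def)

lemma edge_src_chambers:
  assumes X: "chamber_system M X" and i: "i \<in> edges M X"
  shows "edge_src X i \<in> chambers X"
  using assms edge_arr[OF i] groupoid.src_closed[of "panel_groupoid X (fst i)" "snd i"]
  by (auto simp: chamber_system_def edge_src_def)

lemma morphism_gallery_from:
  assumes "chamber_system_morphism M X Y \<omega>"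
  shows "gallery_from M X C es \<Longrightarrow> gallery_from M Y (on_chambers \<omega> C) (map (on_edges \<omega>) es)"
  using assms
  by (induction es arbitrary: C) (auto simp: chamber_system_morphism_def)

lemma morphism_gallery:
  assumes "chamber_system_morphism M X Y \<omega>" "gallery M X \<beta>"
  shows "gallery M Y (image_gallery \<omega> \<beta>)"
  using assms morphism_gallery_from by (fastforce simp: gallery_def image_gallery_def)

lemma morphism_terminal:
  assumes "chamber_system_morphism M X Y \<omega>" "gallery M X \<beta>"
  shows "terminal Y (image_gallery \<omega> \<beta>) = on_chambers \<omega> (terminal X \<beta>)"
proof (cases "snd \<beta> = []")
  case False
  then have "last (snd \<beta>) \<in> edges M X"
    using assms(2) gallery_from_edges[of M X "fst \<beta>" "snd \<beta>"] by (auto simp: gallery_def)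
  then show ?thesis using assms(1) False
    by (simp add: terminal_def image_gallery_def last_map chamber_system_morphism_def)
qed (simp add: terminal_def image_gallery_def)

lemma morphism_gtype:
  assumes "chamber_system_morphism M X Y \<omega>" "gallery M X \<beta>"
  shows "gtype (image_gallery \<omega> \<beta>) = gtype \<beta>"
  using assms gallery_from_edges[of M X "fst \<beta>" "snd \<beta>"]
  by (auto simp: gallery_def gtype_def image_gallery_def chamber_system_morphism_def)

lemma morphism_st_cycle:
  assumes "chamber_system_morphism M X Y \<omega>" "st_cycle M X s t \<beta>"
  shows "st_cycle M Y s t (image_gallery \<omega> \<beta>)"
  using assms morphism_gallery[OF assms(1), of \<beta>] morphism_terminal[OF assms(1), of \<beta>]
    morphism_gtype[OF assms(1), of \<beta>]
  by (auto simp: st_cycle_def initial_def) (simp add: image_gallery_def)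

definition strict_embedding ::
  "'s coxeter \<Rightarrow> ('s, 'c, 'e) weyl_data \<Rightarrow> ('s, 'd, 'f) weyl_data
     \<Rightarrow> ('s, 'c, 'e, 'd, 'f) morphism \<Rightarrow> bool" where
  "strict_embedding M X Y \<omega> \<longleftrightarrow>
     chamber_system_morphism M X Y \<omega> \<and> inj_on (on_edges \<omega>) (edges M X) \<and>
     (\<forall>s t. spherical_pair M s t \<longrightarrow>
        (\<forall>\<beta>\<in>defining_suites X s t. image_gallery \<omega> \<beta> \<in> defining_suites Y s t))"

lemma strict_embedding_elementary:
  assumes X: "chamber_system M X" and \<omega>: "strict_embedding M X Y \<omega>"
    and h: "elementary_homotopy M X \<beta> \<gamma>"
  shows "elementary_homotopy M Y (image_gallery \<omega> \<beta>) (image_gallery \<omega> \<gamma>)"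
proof -
  have m: "chamber_system_morphism M X Y \<omega>" and inj: "inj_on (on_edges \<omega>) (edges M X)"
    using \<omega> by (auto simp: strict_embedding_def)
  show ?thesis using h
  proof cases
    case (delete_inverse C us i vs)
    have g: "gallery M X (C, us @ [i, edge_inv X i] @ vs)" using delete_inverse by simp
    then have "i \<in> edges M X" using gallery_from_edges by (fastforce simp: gallery_def)
    then have "on_edges \<omega> (edge_inv X i) = edge_inv Y (on_edges \<omega> i)"
      using m by (simp add: chamber_system_morphism_def)
    then show ?thesis using morphism_gallery[OF m g] delete_inverse
      elementary_homotopy.delete_inverse[of M Y "on_chambers \<omega> C" "map (on_edges \<omega>) us" "on_edges \<omega> i" "map (on_edges \<omega>) vs"]
      by (simp add: image_gallery_def)
  next
    case (compose C us i j vs)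
    have g: "gallery M X (C, us @ [i, j] @ vs)" using compose by simp
    have gf: "gallery_from M X D (us @ i # j # vs) \<Longrightarrow> edge_src X j = edge_tgt X i" for D
      by (induction us arbitrary: D) auto
    have ij: "i \<in> edges M X" "j \<in> edges M X"
      using g gallery_from_edges by (fastforce simp: gallery_def)+
    have c: "edge_tgt X i = edge_src X j" using g gf[of C] by (simp add: gallery_def)
    have 1: "on_edges \<omega> (edge_comp X i j) = edge_comp Y (on_edges \<omega> i) (on_edges \<omega> j)"
      using m ij c compose by (simp add: chamber_system_morphism_def)
    have 2: "fst (on_edges \<omega> i) = fst (on_edges \<omega> j)"
      using m ij compose by (simp add: chamber_system_morphism_def)
    have 3: "on_edges \<omega> j \<noteq> edge_inv Y (on_edges \<omega> i)"
    proof
      assume "on_edges \<omega> j = edge_inv Y (on_edges \<omega> i)"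
      also have "\<dots> = on_edges \<omega> (edge_inv X i)"
        using m ij by (simp add: chamber_system_morphism_def)
      finally show False
        using inj ij edge_inv_edges[OF X ij(1)] compose by (auto dest: inj_onD)
    qed
    show ?thesis using morphism_gallery[OF m g] compose 1 2 3
      elementary_homotopy.compose[of M Y "on_chambers \<omega> C" "map (on_edges \<omega>) us" "on_edges \<omega> i" "on_edges \<omega> j" "map (on_edges \<omega>) vs"]
      by (simp add: image_gallery_def)
  next
    case (delete_suite C us es vs s t D)
    have g: "gallery M X (C, us @ es @ vs)" using delete_suite by simp
    have "image_gallery \<omega> (D, es) \<in> defining_suites Y s t"
      using \<omega> delete_suite by (auto simp: strict_embedding_def)
    then show ?thesis using morphism_gallery[OF m g] delete_suite
      elementary_homotopy.delete_suite[of M Y "on_chambers \<omega> C" "map (on_edges \<omega>) us" "map (on_edges \<omega>) es" "map (on_edges \<omega>) vs" s t "on_chambers \<omega> D"]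
      by (simp add: image_gallery_def)
  qed
qed

lemma strict_embedding_suite:
  assumes X: "chamber_system M X" and \<omega>: "strict_embedding M X Y \<omega>" and \<beta>: "suite M X \<beta>"
  shows "suite M Y (image_gallery \<omega> \<beta>)"
proof -
  have m: "chamber_system_morphism M X Y \<omega>" using \<omega> by (auto simp: strict_embedding_def)
  obtain s t C where st: "spherical_pair M s t" "st_cycle M X s t \<beta>" and C: "C \<in> chambers X"
    and h: "homotopic M X \<beta> (trivial_gallery C)" using \<beta> by (auto simp: suite_def)
  have "equivclp (elementary_homotopy M Y) (image_gallery \<omega> \<beta>) (image_gallery \<omega> \<gamma>)"
    if "equivclp (elementary_homotopy M X) \<beta> \<gamma>" for \<gamma>
    using that
  proof (induction rule: equivclp_induct)
    case (step y z)
    then show ?case using strict_embedding_elementary[OF X \<omega>]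
      by (meson equivclp_trans r_into_equivclp converse_r_into_equivclp)
  qed simp
  then have "homotopic M Y (image_gallery \<omega> \<beta>) (image_gallery \<omega> (trivial_gallery C))"
    using h morphism_gallery[OF m] by (simp add: homotopic_def)
  moreover have "image_gallery \<omega> (trivial_gallery C) = trivial_gallery (on_chambers \<omega> C)"
    by (simp add: image_gallery_def trivial_gallery_def)
  moreover have "on_chambers \<omega> C \<in> chambers Y"
    using m C by (simp add: chamber_system_morphism_def)
  ultimately show ?thesis using st morphism_st_cycle[OF m st(2)] unfolding suite_def by metis
qed

definition transport_groupoid ::
  "('v \<Rightarrow> 'w) \<Rightarrow> ('a \<Rightarrow> 'b) \<Rightarrow> ('v, 'a) groupoid \<Rightarrow> ('w, 'b) groupoid" where
  "transport_groupoid F G P =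
     (let f = inv_into (verts P) F; g = inv_into (arrs P) G in
      \<lparr>verts = F ` verts P, arrs = G ` arrs P,
       src = (\<lambda>x. F (src P (g x))), tgt = (\<lambda>x. F (tgt P (g x))), ident = (\<lambda>v. G (ident P (f v))),
       gcomp = (\<lambda>x y. G (gcomp P (g x) (g y))), ginv = (\<lambda>x. G (ginv P (g x)))\<rparr>)"

lemma transport_groupoid_simps:
  assumes "inj_on F (verts P)" "inj_on G (arrs P)"
  shows "verts (transport_groupoid F G P) = F ` verts P"
    "arrs (transport_groupoid F G P) = G ` arrs P"
    "a \<in> arrs P \<Longrightarrow> src (transport_groupoid F G P) (G a) = F (src P a)"
    "a \<in> arrs P \<Longrightarrow> tgt (transport_groupoid F G P) (G a) = F (tgt P a)"
    "v \<in> verts P \<Longrightarrow> ident (transport_groupoid F G P) (F v) = G (ident P v)"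
    "a \<in> arrs P \<Longrightarrow> b \<in> arrs P \<Longrightarrow> gcomp (transport_groupoid F G P) (G a) (G b) = G (gcomp P a b)"
    "a \<in> arrs P \<Longrightarrow> ginv (transport_groupoid F G P) (G a) = G (ginv P a)"
  using assms by (auto simp: transport_groupoid_def Let_def)

lemma groupoid_transport:
  assumes P: "groupoid P" and F: "inj_on F (verts P)" and G: "inj_on G (arrs P)"
  shows "groupoid (transport_groupoid F G P)"
proof -
  interpret P: groupoid P by (rule P)
  note [simp] = transport_groupoid_simps[OF F G]
    P.src_closed P.tgt_closed P.ident_closed P.src_ident P.tgt_ident P.comp_closed P.src_comp
    P.tgt_comp P.comp_assoc P.ident_comp P.comp_ident P.inver_closed P.src_inver P.tgt_inver
    P.comp_inver P.inver_comp
  have [simp]: "F (tgt P a) = F (src P b) \<longleftrightarrow> tgt P a = src P b" if "a \<in> arrs P" "b \<in> arrs P" for a b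
    using that F by (auto dest: inj_onD)
  show ?thesis by unfold_locales (auto simp: P.verts_nonempty)
qed

definition transport ::
  "('c \<Rightarrow> 'd) \<Rightarrow> ('s \<Rightarrow> 'e \<Rightarrow> 'f) \<Rightarrow> ('s, 'c, 'e) weyl_data \<Rightarrow> ('s, 'd, 'f) weyl_data" where
  "transport F G X =
     \<lparr>chambers = F ` chambers X,
      panel_groupoid = (\<lambda>s. transport_groupoid F (G s) (panel_groupoid X s)),
      defining_suites = (\<lambda>s t. image_gallery \<lparr>on_chambers = F, on_edges = (\<lambda>i. (fst i, G (fst i) (snd i)))\<rparr> ` defining_suites X s t)\<rparr>"

locale transport_data =
  fixes M :: "'s coxeter" and X :: "('s, 'c, 'e) weyl_data"
    and F :: "'c \<Rightarrow> 'd" and G :: "'s \<Rightarrow> 'e \<Rightarrow> 'f"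
  assumes X: "weyl_data M X"
    and F: "inj_on F (chambers X)"
    and G: "s \<in> gens M \<Longrightarrow> inj_on (G s) (arrs (panel_groupoid X s))"
begin

abbreviation "X' \<equiv> transport F G X"

definition "\<theta> = \<lparr>on_chambers = F, on_edges = (\<lambda>i. (fst i, G (fst i) (snd i)))\<rparr>"

definition "\<theta>' = \<lparr>on_chambers = inv_into (chambers X) F,
  on_edges = (\<lambda>i. (fst i, inv_into (arrs (panel_groupoid X (fst i))) (G (fst i)) (snd i)))\<rparr>"

lemma cs: "chamber_system M X" using X by (simp add: weyl_data_def)

lemma panel: assumes "s \<in> gens M"
  shows "groupoid (panel_groupoid X s)" "verts (panel_groupoid X s) = chambers X"
    "inj_on F (verts (panel_groupoid X s))"
  using cs assms F by (auto simp: chamber_system_def)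

lemma cs': "chamber_system M X'"
proof -
  have "chambers X \<noteq> {}" using cs by (simp add: chamber_system_def)
  moreover have "groupoid (transport_groupoid F (G s) (panel_groupoid X s))"
    "verts (transport_groupoid F (G s) (panel_groupoid X s)) = F ` chambers X" if "s \<in> gens M" for s
    using groupoid_transport[OF panel(1,3)[OF that] G[OF that]]
      transport_groupoid_simps(1)[OF panel(3)[OF that] G[OF that]] panel(2)[OF that] by auto
  ultimately show ?thesis by (simp add: chamber_system_def transport_def)
qed

lemma \<theta>_chambers: "chambers X' = on_chambers \<theta> ` chambers X"
  by (simp add: transport_def \<theta>_def)

lemma \<theta>'_chamber: "C \<in> chambers X \<Longrightarrow> on_chambers \<theta>' (on_chambers \<theta> C) = C"
  using F by (simp add: \<theta>_def \<theta>'_def)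

lemma \<theta>'_edge: "i \<in> edges M X \<Longrightarrow> on_edges \<theta>' (on_edges \<theta> i) = i"
  using G edge_arr[of i M X] by (simp add: \<theta>_def \<theta>'_def)

lemma \<theta>_edges: "edges M X' = on_edges \<theta> ` edges M X"
proof -
  have "(s, x) \<in> edges M X' \<longleftrightarrow> (s, x) \<in> on_edges \<theta> ` edges M X" for s x
  proof (cases "s \<in> gens M")
    case True
    note p = panel[OF True] and g = G[OF True]
    note sm = transport_groupoid_simps[OF p(3) g]
    have id: "ident (panel_groupoid X s) C \<in> arrs (panel_groupoid X s)" if "C \<in> chambers X" for C
      using p groupoid.ident_closed that by metis
    have "(s, x) \<in> edges M X' \<longleftrightarrow>
      x \<in> G s ` arrs (panel_groupoid X s) \<and> (\<forall>C\<in>chambers X. x \<noteq> G s (ident (panel_groupoid X s) C))"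
      using True sm p(2) by (auto simp: edges_def transport_def)
    also have "\<dots> \<longleftrightarrow> (\<exists>e. (s, e) \<in> edges M X \<and> x = G s e)"
      using True g id by (fastforce simp: edges_def dest: inj_onD)
    finally show ?thesis by (force simp: \<theta>_def)
  qed (auto simp: edges_def \<theta>_def)
  then show ?thesis by auto
qed

lemma edge_ops:
  assumes "i \<in> edges M X"
  shows "edge_src X' (on_edges \<theta> i) = on_chambers \<theta> (edge_src X i)"
    "edge_tgt X' (on_edges \<theta> i) = on_chambers \<theta> (edge_tgt X i)"
    "edge_inv X' (on_edges \<theta> i) = on_edges \<theta> (edge_inv X i)"
    "fst (on_edges \<theta> i) = fst i"
    "j \<in> edges M X \<Longrightarrow> fst i = fst j \<Longrightarrow> edge_comp X' (on_edges \<theta> i) (on_edges \<theta> j) = on_edges \<theta> (edge_comp X i j)"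
proof -
  have s: "fst i \<in> gens M" and a: "snd i \<in> arrs (panel_groupoid X (fst i))"
    using edge_arr[OF assms] by auto
  note sm = transport_groupoid_simps[OF panel(3)[OF s] G[OF s]]
  show "edge_src X' (on_edges \<theta> i) = on_chambers \<theta> (edge_src X i)"
    "edge_tgt X' (on_edges \<theta> i) = on_chambers \<theta> (edge_tgt X i)"
    "edge_inv X' (on_edges \<theta> i) = on_edges \<theta> (edge_inv X i)"
    "fst (on_edges \<theta> i) = fst i"
    using a by (auto simp: edge_src_def edge_tgt_def edge_inv_def transport_def \<theta>_def sm)
  show "edge_comp X' (on_edges \<theta> i) (on_edges \<theta> j) = on_edges \<theta> (edge_comp X i j)"
    if "j \<in> edges M X" "fst i = fst j"
    using a edge_arr[OF that(1)] that(2) sm by (auto simp: edge_comp_def transport_def \<theta>_def)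
qed

lemma edge_comp_edges:
  assumes "i \<in> edges M X" "j \<in> edges M X" "fst i = fst j" "edge_tgt X i = edge_src X j" "j \<noteq> edge_inv X i"
  shows "edge_comp X i j \<in> edges M X"
proof -
  obtain s e h where [simp]: "i = (s, e)" "j = (s, h)" using assms(3) by (cases i, cases j) auto
  let ?P = "panel_groupoid X s"
  have s: "s \<in> gens M" and e: "e \<in> arrs ?P" and h: "h \<in> arrs ?P"
    using assms(1,2) by (auto simp: edges_def)
  interpret P: groupoid ?P by (rule panel(1)[OF s])
  have c: "tgt ?P e = src ?P h" using assms(4) by (simp add: edge_src_def edge_tgt_def)
  have "gcomp ?P e h \<noteq> ident ?P C" if C: "C \<in> chambers X" for C
  proof
    assume eq: "gcomp ?P e h = ident ?P C"
    have v: "C \<in> verts ?P" using C panel(2)[OF s] by simp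
    have sC: "src ?P e = C" and tC: "tgt ?P h = C"
      using P.src_comp[OF e h c] P.tgt_comp[OF e h c] eq P.src_ident[OF v] P.tgt_ident[OF v] by auto
    have "h = gcomp ?P (gcomp ?P (ginv ?P e) e) h"
      using P.inver_comp[OF e] P.ident_comp[OF h] c by simp
    also have "\<dots> = gcomp ?P (ginv ?P e) (gcomp ?P e h)"
      using P.comp_assoc[OF P.inver_closed[OF e] e h] P.tgt_inver[OF e] c by simp
    also have "\<dots> = ginv ?P e"
      using P.comp_ident[OF P.inver_closed[OF e]] P.tgt_inver[OF e] sC eq by simp
    finally show False using assms(5) by (simp add: edge_inv_def)
  qed
  then show ?thesis using s P.comp_closed[OF e h c] by (auto simp: edges_def edge_comp_def)
qed

lemma \<theta>_morphism: "chamber_system_morphism M X X' \<theta>"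
  unfolding chamber_system_morphism_def
  by (auto simp: \<theta>_chambers \<theta>_edges edge_ops)

lemma \<theta>'_morphism: "chamber_system_morphism M X' X \<theta>'"
proof -
  have neq: "j \<noteq> edge_inv X i"
    if "on_edges \<theta> j \<noteq> on_edges \<theta> (edge_inv X i)" for i j
    using that by auto
  have cmp: "edge_tgt X i = edge_src X j"
    if "i \<in> edges M X" "j \<in> edges M X"
      "on_chambers \<theta> (edge_tgt X i) = on_chambers \<theta> (edge_src X j)" for i j
    using that(3) \<theta>'_chamber edge_tgt_chambers[OF cs that(1)] edge_src_chambers[OF cs that(2)] by metis
  show ?thesis
    unfolding chamber_system_morphism_def \<theta>_chambers \<theta>_edges
    by (auto simp: edge_ops \<theta>'_chamber \<theta>'_edge edge_tgt_chambers[OF cs]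
        edge_src_chambers[OF cs] edge_inv_edges[OF cs] intro!: \<theta>'_edge edge_comp_edges dest: cmp)
qed

lemma \<theta>'_gallery: "gallery M X \<beta> \<Longrightarrow> image_gallery \<theta>' (image_gallery \<theta> \<beta>) = \<beta>"
proof -
  assume g: "gallery M X \<beta>"
  have "gallery_from M X C es \<Longrightarrow> C \<in> chambers X" for C es
    using edge_src_chambers[OF cs] by (cases es) auto
  with g have "fst \<beta> \<in> chambers X" by (auto simp: gallery_def)
  moreover have "map (on_edges \<theta>') (map (on_edges \<theta>) (snd \<beta>)) = snd \<beta>"
    using g gallery_from_edges[of M X "fst \<beta>" "snd \<beta>"] \<theta>'_edge
    by (auto simp: gallery_def intro!: map_idI)
  ultimately show ?thesis by (simp add: image_gallery_def \<theta>'_chamber)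
qed

lemma suites': "defining_suites X' s t = image_gallery \<theta> ` defining_suites X s t"
  by (simp add: transport_def \<theta>_def)

lemma \<theta>_strict: "strict_embedding M X X' \<theta>"
  unfolding strict_embedding_def using \<theta>_morphism suites' inj_on_inverseI[where g = "on_edges \<theta>'" and f = "on_edges \<theta>" and A = "edges M X", OF \<theta>'_edge] by auto

lemma \<theta>'_strict: "strict_embedding M X' X \<theta>'"
proof -
  have "gallery M X \<beta>" if "spherical_pair M s t" "\<beta> \<in> defining_suites X s t" for s t \<beta>
    using X that by (auto simp: weyl_data_def st_cycle_def)
  moreover have "inj_on (on_edges \<theta>') (edges M X')"
    by (rule inj_on_inverseI[where g = "on_edges \<theta>"]) (auto simp: \<theta>_edges \<theta>'_edge)
  ultimately show ?thesis
    unfolding strict_embedding_def using \<theta>'_morphism by (auto simp: suites' \<theta>'_gallery)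
qed

lemma X': "weyl_data M X'"
  using X cs' morphism_st_cycle[OF \<theta>_morphism] by (fastforce simp: weyl_data_def suites')

lemma connected': "connected_system M X \<Longrightarrow> connected_system M X'"
  unfolding connected_system_def \<theta>_chambers
proof (intro ballI)
  fix x y assume c: "\<forall>C\<in>chambers X. \<forall>D\<in>chambers X. \<exists>\<beta>. gallery M X \<beta> \<and> initial \<beta> = C \<and> terminal X \<beta> = D"
    and "x \<in> on_chambers \<theta> ` chambers X" "y \<in> on_chambers \<theta> ` chambers X"
  then obtain C D where "C \<in> chambers X" "D \<in> chambers X" "x = on_chambers \<theta> C" "y = on_chambers \<theta> D"
    by auto
  with c obtain \<beta> where "gallery M X \<beta>" "initial \<beta> = C" "terminal X \<beta> = D" by blast
  then show "\<exists>\<beta>. gallery M X' \<beta> \<and> initial \<beta> = x \<and> terminal X' \<beta> = y"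
    using morphism_gallery[OF \<theta>_morphism, of \<beta>] morphism_terminal[OF \<theta>_morphism, of \<beta>]
      \<open>x = _\<close> \<open>y = _\<close>
    by (intro exI[of _ "image_gallery \<theta> \<beta>"]) (auto simp: initial_def image_gallery_def)
qed

definition "pull q = \<lparr>on_chambers = (\<lambda>x. on_chambers q (on_chambers \<theta>' x)),
  on_edges = (\<lambda>x. on_edges q (on_edges \<theta>' x))\<rparr>"

lemma image_pull: "image_gallery (pull q) \<beta> = image_gallery q (image_gallery \<theta>' \<beta>)"
  by (simp add: image_gallery_def pull_def)

lemma covering':
  assumes q: "covering M X Y q"
  shows "covering M X' Y (pull q)"
proof -
  have qm: "chamber_system_morphism M X Y q" using q by (simp add: covering_def weyl_data_morphism_def)
  have cmp: "edge_tgt X i = edge_src X j"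
    if "i \<in> edges M X" "j \<in> edges M X"
      "on_chambers \<theta> (edge_tgt X i) = on_chambers \<theta> (edge_src X j)" for i j
    using that(3) \<theta>'_chamber edge_tgt_chambers[OF cs that(1)] edge_src_chambers[OF cs that(2)] by metis
  have mor: "chamber_system_morphism M X' Y (pull q)"
  proof -
    have c: "edge_comp X i j \<in> edges M X \<and> edge_tgt X i = edge_src X j \<and> j \<noteq> edge_inv X i"
      if "i \<in> edges M X" "j \<in> edges M X" "fst i = fst j"
      "on_chambers \<theta> (edge_tgt X i) = on_chambers \<theta> (edge_src X j)"
      "on_edges \<theta> j \<noteq> on_edges \<theta> (edge_inv X i)" for i j
      using that cmp[OF that(1,2,4)] edge_comp_edges by blast
    show ?thesis
      unfolding chamber_system_morphism_def \<theta>_chambers \<theta>_edges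
      using qm c
      by (auto simp: edge_ops \<theta>'_chamber \<theta>'_edge edge_tgt_chambers[OF cs] pull_def
        edge_src_chambers[OF cs] edge_inv_edges[OF cs] chamber_system_morphism_def)
  qed
  have def_gal: "gallery M X \<beta>" if "spherical_pair M s t" "\<beta> \<in> defining_suites X s t" for s t \<beta>
    using X that by (auto simp: weyl_data_def st_cycle_def)
  have wm: "weyl_data_morphism M X' Y (pull q)"
    using mor q def_gal
    by (auto simp: weyl_data_morphism_def covering_def suites' image_pull \<theta>'_gallery)
  have et: "surjective_etale M X' Y (pull q)"
    unfolding surjective_etale_def \<theta>_chambers \<theta>_edges
  proof (intro conjI ballI)
    show "on_chambers (pull q) ` on_chambers \<theta> ` chambers X = chambers Y"
      using q by (simp add: covering_def surjective_etale_def pull_def image_image \<theta>'_chamber)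
    fix x assume "x \<in> on_chambers \<theta> ` chambers X"
    then obtain C where C: "C \<in> chambers X" and x: "x = on_chambers \<theta> C" by auto
    let ?E = "{i \<in> edges M X. edge_src X i = C}"
    have inj: "on_chambers \<theta> D = on_chambers \<theta> C \<longleftrightarrow> D = C" if "D \<in> chambers X" for D
      using C that \<theta>'_chamber by metis
    have E: "{i \<in> on_edges \<theta> ` edges M X. edge_src X' i = x} = on_edges \<theta> ` ?E"
      using edge_src_chambers[OF cs] by (auto simp: edge_ops x inj)
    have b1: "bij_betw (on_edges \<theta>') (on_edges \<theta> ` ?E) ?E"
      by (rule bij_betw_byWitness[where f' = "on_edges \<theta>"]) (auto simp: \<theta>'_edge)
    have "bij_betw (on_edges q) ?E {j \<in> edges M Y. edge_src Y j = on_chambers q C}"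
      using q C by (simp add: covering_def surjective_etale_def)
    from bij_betw_trans[OF b1 this]
    show "bij_betw (on_edges (pull q)) {i \<in> on_edges \<theta> ` edges M X. edge_src X' i = x}
       {j \<in> edges M Y. edge_src Y j = on_chambers (pull q) x}"
      unfolding E using C by (simp add: pull_def x \<theta>'_chamber o_def)
  qed
  have "suite M X' \<beta>" if st: "spherical_pair M s t" "gallery M X' \<beta>" "image_gallery (pull q) \<beta> \<in> defining_suites Y s t" for s t \<beta>
  proof -
    have "suite M X (image_gallery \<theta>' \<beta>)"
      using q st morphism_gallery[OF \<theta>'_morphism st(2)]
      unfolding covering_def image_pull by blast
    from strict_embedding_suite[OF cs \<theta>_strict this]
    have "suite M X' (image_gallery \<theta> (image_gallery \<theta>' \<beta>))" .
    moreover have "image_gallery \<theta> (image_gallery \<theta>' \<beta>) = \<beta>"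
    proof -
      have "gallery_from M X' C es \<Longrightarrow> C \<in> chambers X'" for C es
        using edge_src_chambers[OF cs'] by (cases es) auto
      then have "fst \<beta> \<in> chambers X'" using st(2) by (auto simp: gallery_def)
      then have "on_chambers \<theta> (on_chambers \<theta>' (fst \<beta>)) = fst \<beta>"
        by (auto simp: \<theta>_chambers \<theta>'_chamber)
      moreover have "map (on_edges \<theta>) (map (on_edges \<theta>') (snd \<beta>)) = snd \<beta>"
        using st(2) gallery_from_edges[of M X' "fst \<beta>" "snd \<beta>"] \<theta>'_edge
        by (auto simp: gallery_def \<theta>_edges intro!: map_idI)
      ultimately show ?thesis by (simp add: image_gallery_def)
    qed
    ultimately show ?thesis by simp
  qed
  then show ?thesis using X' wm et q by (auto simp: covering_def)
qed

lemma factors':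
  assumes f: "factors_through M V p X' (pull q)" and V: "weyl_data M V"
  shows "factors_through M V p X q"
proof -
  obtain \<mu> where \<mu>: "weyl_data_morphism M V X' \<mu>"
    and c: "\<And>C. C \<in> chambers V \<Longrightarrow> on_chambers p C = on_chambers (pull q) (on_chambers \<mu> C)"
    and e: "\<And>i. i \<in> edges M V \<Longrightarrow> on_edges p i = on_edges (pull q) (on_edges \<mu> i)"
    using f by (auto simp: factors_through_def)
  let ?\<nu> = "\<lparr>on_chambers = (\<lambda>x. on_chambers \<theta>' (on_chambers \<mu> x)),
     on_edges = (\<lambda>x. on_edges \<theta>' (on_edges \<mu> x))\<rparr>"
  have m: "chamber_system_morphism M V X' \<mu>" using \<mu> by (simp add: weyl_data_morphism_def)
  have Vcs: "chamber_system M V" using V by (simp add: weyl_data_def)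
  have neq: "on_edges \<mu> j \<noteq> edge_inv X' (on_edges \<mu> i)"
    if ij: "i \<in> edges M V" "j \<in> edges M V" "fst i = fst j" "edge_tgt V i = edge_src V j" "j \<noteq> edge_inv V i"
    for i j
  proof
    assume eq: "on_edges \<mu> j = edge_inv X' (on_edges \<mu> i)"
    interpret V: transport_data M V "\<lambda>x. x" "\<lambda>s x. x"
      using V by unfold_locales (auto simp: inj_on_def)
    have "on_edges \<mu> (edge_comp V i j) \<in> edges M X'"
      using V.edge_comp_edges[OF ij] m by (simp add: chamber_system_morphism_def)
    moreover have "on_edges \<mu> (edge_comp V i j) = edge_comp X' (on_edges \<mu> i) (edge_inv X' (on_edges \<mu> i))"
      using m ij by (simp add: chamber_system_morphism_def flip: eq)
    moreover have i': "on_edges \<mu> i \<in> edges M X'" using m ij by (simp add: chamber_system_morphism_def)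
    moreover have "groupoid (panel_groupoid X' (fst (on_edges \<mu> i)))"
      "edge_src X' (on_edges \<mu> i) \<in> chambers X'"
      using edge_arr[OF i'] cs' edge_src_chambers[OF cs' i'] by (auto simp: chamber_system_def)
    ultimately show False
      using edge_arr[OF i'] groupoid.comp_inver
      by (fastforce simp: edges_def edge_comp_def edge_inv_def edge_src_def)
  qed
  have n: "chamber_system_morphism M V X ?\<nu>"
    using m \<theta>'_morphism neq
    unfolding chamber_system_morphism_def by simp
  have im: "image_gallery ?\<nu> \<beta> = image_gallery \<theta>' (image_gallery \<mu> \<beta>)" for \<beta>
    by (simp add: image_gallery_def)
  have "weyl_data_morphism M V X ?\<nu>"
    using n \<mu> strict_embedding_suite[OF cs' \<theta>'_strict] by (auto simp: weyl_data_morphism_def im)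
  then show ?thesis unfolding factors_through_def using c e
    by (intro exI[of _ ?\<nu>]) (auto simp: pull_def)
qed

end

lemma etale_unique_lift:
  assumes Z: "chamber_system M Z" and et: "surjective_etale M Z Y q"
    and m: "chamber_system_morphism M Z Y q"
  shows "gallery_from M Z C es \<Longrightarrow> gallery_from M Z C es' \<Longrightarrow>
    map (on_edges q) es = map (on_edges q) es' \<Longrightarrow> es = es'"
proof (induction es arbitrary: C es')
  case (Cons i es)
  then obtain j js where es': "es' = j # js" by (cases es') auto
  have ij: "i \<in> edges M Z" "edge_src Z i = C" "j \<in> edges M Z" "edge_src Z j = C"
    and eq: "on_edges q i = on_edges q j"
    using Cons.prems es' by auto
  have "C \<in> chambers Z" using edge_src_chambers[OF Z ij(1)] ij by simp
  then have "inj_on (on_edges q) {i \<in> edges M Z. edge_src Z i = C}"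
    using et by (simp add: surjective_etale_def bij_betw_def)
  then have "i = j" using ij eq by (auto dest: inj_onD)
  then show ?case using Cons es' by auto
qed simp

lemma universal_cover_factors:
  fixes Y :: "('s, 'd, 'f) weyl_data" and Z :: "('s, 'a, 'b) weyl_data"
  assumes p: "universal_cover M X Y p" and q: "connected_covering M Z Y q"
  shows "factors_through M X p Z q"
proof -
  have Zw: "weyl_data M Z" and et: "surjective_etale M Z Y q" and m: "chamber_system_morphism M Z Y q"
    and Zc: "connected_system M Z"
    using q by (auto simp: connected_covering_def covering_def weyl_data_morphism_def)
  have Z: "chamber_system M Z" using Zw by (simp add: weyl_data_def)
  obtain C0 where C0: "C0 \<in> chambers Z" using Z by (auto simp: chamber_system_def)
  define F where "F D = {image_gallery q \<gamma> | \<gamma>. gallery M Z \<gamma> \<and> initial \<gamma> = C0 \<and> terminal Z \<gamma> = D}" for D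
  define G where "G s e =
    (F (src (panel_groupoid Z s) e),
     if \<exists>C\<in>chambers Z. e = ident (panel_groupoid Z s) C
     then ident (panel_groupoid Y s) (on_chambers q (src (panel_groupoid Z s) e))
     else snd (on_edges q (s, e)))" for s e
  have F: "inj_on F (chambers Z)"
  proof (rule inj_onI)
    fix D D' assume D: "D \<in> chambers Z" "D' \<in> chambers Z" and eq: "F D = F D'"
    obtain \<gamma> where \<gamma>: "gallery M Z \<gamma>" "initial \<gamma> = C0" "terminal Z \<gamma> = D"
      using Zc C0 D unfolding connected_system_def by meson
    then have "image_gallery q \<gamma> \<in> F D'" unfolding eq[symmetric] unfolding F_def by blast
    then obtain \<gamma>' where \<gamma>': "gallery M Z \<gamma>'" "initial \<gamma>' = C0" "terminal Z \<gamma>' = D'"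
      "image_gallery q \<gamma> = image_gallery q \<gamma>'" by (auto simp: F_def)
    then have "snd \<gamma> = snd \<gamma>'" using \<gamma> etale_unique_lift[OF Z et m, of C0 "snd \<gamma>" "snd \<gamma>'"]
      by (auto simp: gallery_def initial_def image_gallery_def)
    then have "\<gamma> = \<gamma>'" using \<gamma> \<gamma>' by (simp add: initial_def prod_eq_iff)
    then show "D = D'" using \<gamma> \<gamma>' by simp
  qed
  have G: "inj_on (G s) (arrs (panel_groupoid Z s))" if s: "s \<in> gens M" for s
  proof (rule inj_onI)
    let ?P = "panel_groupoid Z s"
    let ?id = "\<lambda>e. \<exists>C\<in>chambers Z. e = ident ?P C"
    interpret P: groupoid ?P using Z s by (simp add: chamber_system_def)
    have v: "verts ?P = chambers Z" using Z s by (simp add: chamber_system_def)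
    fix e e' assume e: "e \<in> arrs ?P" "e' \<in> arrs ?P" and eq: "G s e = G s e'"
    have src: "src ?P e = src ?P e'"
      using eq F e P.src_closed v by (auto simp: G_def dest: inj_onD)
    have srcZ: "src ?P e \<in> chambers Z" using e P.src_closed v by auto
    then have qs: "on_chambers q (src ?P e) \<in> chambers Y" using m by (simp add: chamber_system_morphism_def)
    have edge: "(s, a) \<in> edges M Z" if "a \<in> arrs ?P" "\<not> ?id a" for a
      using that s by (auto simp: edges_def)
    have nid: "snd (on_edges q (s, a)) \<noteq> ident (panel_groupoid Y s) (on_chambers q (src ?P e))"
      if "a \<in> arrs ?P" "\<not> ?id a" for a
    proof -
      have "on_edges q (s, a) \<in> edges M Y" "fst (on_edges q (s, a)) = s"
        using m edge[OF that] by (auto simp: chamber_system_morphism_def)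
      then show ?thesis using qs by (auto simp: edges_def)
    qed
    consider "?id e" "?id e'" | "?id e" "\<not> ?id e'" | "\<not> ?id e" "?id e'" | "\<not> ?id e" "\<not> ?id e'" by blast
    then show "e = e'"
    proof cases
      case 1 then show ?thesis using src v P.src_ident by auto
    next
      case 2 then show ?thesis using eq nid[of e'] e src by (simp add: G_def)
    next
      case 3 then show ?thesis using eq nid[of e] e src by (simp add: G_def)
    next
      case 4
      have "fst (on_edges q (s, e)) = s" "fst (on_edges q (s, e')) = s"
        using m edge 4 e by (auto simp: chamber_system_morphism_def)
      moreover have "snd (on_edges q (s, e)) = snd (on_edges q (s, e'))"
        using eq 4 by (simp add: G_def)
      ultimately have "on_edges q (s, e) = on_edges q (s, e')" by (simp add: prod_eq_iff)
      moreover have "inj_on (on_edges q) {i \<in> edges M Z. edge_src Z i = src ?P e}"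
        using et srcZ by (simp add: surjective_etale_def bij_betw_def)
      ultimately have "(s, e) = (s, e')"
        using edge 4 e src by (auto simp: edge_src_def dest!: inj_onD)
      then show ?thesis by simp
    qed
  qed
  interpret transport_data M Z F G
    using Zw F G by unfold_locales auto
  have "connected_covering M (transport F G Z) Y (pull q)"
    using q covering' connected' by (auto simp: connected_covering_def)
  then have "factors_through M X p (transport F G Z) (pull q)"
    using p by (simp add: universal_cover_def)
  then show ?thesis
    using factors' p by (auto simp: universal_cover_def connected_covering_def covering_def)
qed

end

(*
  Homotopies of galleries lift uniquely along a covering and project back down, so each of the
  conditions (PW0), (PW1) and (W) holds upstairs if and only if it holds downstairs; this gives the
  second claim and all of the first except simple connectedness.  For the latter, the homotopy
  classes of galleries starting at a fixed chamber form a connected covering in which galleries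
  with equal ends are homotopic.  The universal cover maps to it over the base, so two galleries of
  the universal cover with equal ends have homotopic images in the base, and this homotopy lifts.
*)
theory Submission
  imports Defs
begin

text \<open>The universal property yields only a morphism to a competing covering, with no inverse
  and no injectivity. Hence equality of ends is what travels along it, and homotopy has to come back
  through the base. The covering by classes is an action construction: galleries act on the classes
  of galleries from a base chamber by appending. Its key property is that the action is free. If
  \<open>a\<close> extended by \<open>es\<close> and by \<open>fs\<close> gives the same class, then
  \<open>es\<close> and \<open>fs\<close> are homotopic, because edges are invertible up to homotopy
  and a common prefix cancels. An endpoint in the covering thus remembers a homotopy class of the
  base. Two mismatches shape the details. Panel groupoids contain identity arrows, whereas edges,
  and the bijections in the definition of a covering, exclude them; hence the translation between
  arrows and words of length at most one. And defining suites are carried by morphisms and by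
  lifting only to suites, so one elementary move may become a whole homotopy on the other
  side.\<close>

section \<open>Galleries as edge lists; inverses and composites of edges\<close>

lemma terminal_Nil [simp]: "terminal X (C, []) = C"
  by (simp add: terminal_def)

lemma terminal_Cons [simp]: "terminal X (C, i # es) = terminal X (edge_tgt X i, es)"
  by (simp add: terminal_def)

lemma terminal_append [simp]: "terminal X (C, us @ vs) = terminal X (terminal X (C, us), vs)"
  by (induction us arbitrary: C) auto

lemma gallery_from_initial:
  "chamber_system M X \<Longrightarrow> gallery_from M X C es \<Longrightarrow> C \<in> chambers X"
  using edge_src_chambers by (cases es) auto

lemma gallery_from_terminal:
  "gallery_from M X C es \<Longrightarrow> terminal X (C, es) \<in> chambers X"
  by (induction es arbitrary: C) auto

lemma gallery_from_append:
  assumes "chamber_system M X"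
  shows "gallery_from M X C (us @ vs) \<longleftrightarrow>
    gallery_from M X C us \<and> gallery_from M X (terminal X (C, us)) vs"
  using gallery_from_initial[OF assms] by (induction us arbitrary: C) auto

lemma gallery_Pair [simp]: "gallery M X (C, es) \<longleftrightarrow> gallery_from M X C es"
  by (simp add: gallery_def)

lemma gallery_from_unique:
  "gallery_from M X C es \<Longrightarrow> gallery_from M X D es \<Longrightarrow> es \<noteq> [] \<Longrightarrow> C = D"
  by (cases es) auto

lemma edge_inv_simps:
  assumes X: "chamber_system M X" and i: "i \<in> edges M X"
  shows "edge_src X (edge_inv X i) = edge_tgt X i" "edge_tgt X (edge_inv X i) = edge_src X i"
    "fst (edge_inv X i) = fst i" "edge_inv X (edge_inv X i) = i"
proof -
  let ?P = "panel_groupoid X (fst i)"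
  have s: "fst i \<in> gens M" and e: "snd i \<in> arrs ?P" using edge_arr[OF i] by auto
  interpret P: groupoid ?P using X s by (simp add: chamber_system_def)
  show "edge_src X (edge_inv X i) = edge_tgt X i" "edge_tgt X (edge_inv X i) = edge_src X i"
    "fst (edge_inv X i) = fst i"
    using P.src_inver[OF e] P.tgt_inver[OF e] by (auto simp: edge_src_def edge_tgt_def edge_inv_def)
  let ?g = "ginv ?P (snd i)"
  have g: "?g \<in> arrs ?P" "ginv ?P ?g \<in> arrs ?P" using P.inver_closed e by auto
  have "ginv ?P ?g = gcomp ?P (gcomp ?P (snd i) ?g) (ginv ?P ?g)"
    using P.ident_comp[OF g(2)] P.comp_inver[OF e] P.src_inver[OF g(1)] P.tgt_inver[OF e] by simp
  also have "\<dots> = gcomp ?P (snd i) (gcomp ?P ?g (ginv ?P ?g))"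
    using P.comp_assoc[OF e g] P.src_inver[OF e] P.src_inver[OF g(1)] by simp
  also have "\<dots> = snd i"
    using P.comp_inver[OF g(1)] P.src_inver[OF e] P.comp_ident[OF e] by simp
  finally show "edge_inv X (edge_inv X i) = i" by (simp add: edge_inv_def)
qed

lemma edge_comp_simps:
  assumes X: "chamber_system M X" and i: "i \<in> edges M X" and j: "j \<in> edges M X"
    and s: "fst i = fst j" and c: "edge_tgt X i = edge_src X j"
  shows "edge_src X (edge_comp X i j) = edge_src X i" "edge_tgt X (edge_comp X i j) = edge_tgt X j"
    "fst (edge_comp X i j) = fst i"
proof -
  interpret P: groupoid "panel_groupoid X (fst j)"
    using X edge_arr[OF j] by (simp add: chamber_system_def)
  show "edge_src X (edge_comp X i j) = edge_src X i" "edge_tgt X (edge_comp X i j) = edge_tgt X j"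
    "fst (edge_comp X i j) = fst i"
    using P.src_comp P.tgt_comp edge_arr[OF i] edge_arr[OF j] s c
    by (auto simp: edge_src_def edge_tgt_def edge_comp_def)
qed

lemma component_simps:
  "verts (component G v) = {w. \<exists>g\<in>arrs G. src G g = v \<and> tgt G g = w}"
  "arrs (component G v) = {g \<in> arrs G. \<exists>h\<in>arrs G. src G h = v \<and> tgt G h = src G g}"
  by (simp_all add: component_def Let_def)

section \<open>Homotopy\<close>

locale weyl =
  fixes M :: "'s coxeter" and X :: "('s, 'c, 'e) weyl_data"
  assumes X: "weyl_data M X"
begin

lemma cs: "chamber_system M X"
  using X by (simp add: weyl_data_def)

lemma edge_comp_edges:
  assumes "i \<in> edges M X" "j \<in> edges M X" "fst i = fst j" "edge_tgt X i = edge_src X j"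
    "j \<noteq> edge_inv X i"
  shows "edge_comp X i j \<in> edges M X"
proof -
  \<comment> \<open>Closure of edges under composition is available inside
    \<open>transport_data\<close>; transporting along identity maps gives access to it.\<close>
  interpret transport_data M X "\<lambda>x. x" "\<lambda>s x. x"
    using X by unfold_locales auto
  show ?thesis by (rule edge_comp_edges) fact+
qed

lemma suite_cycle:
  assumes "spherical_pair M s t" "(D, es) \<in> defining_suites X s t"
  shows "gallery_from M X D es" "terminal X (D, es) = D"
  using X assms by (fastforce simp: weyl_data_def st_cycle_def initial_def)+

text \<open>The move that deletes a suite matches only its edge list \<open>es\<close>, not its
  recorded base \<open>D\<close>. A nonempty list determines where it starts, so
  \<open>C = D\<close>; the empty list fits at any chamber and is closed anyway.\<close>

lemma suite_cycle_at:
  assumes "spherical_pair M s t" "(D, es) \<in> defining_suites X s t" "gallery_from M X C es"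
  shows "terminal X (C, es) = C" "es \<noteq> [] \<Longrightarrow> C = D"
  using suite_cycle[OF assms(1,2)] gallery_from_unique[OF assms(3), of D]
  by (cases "es = []"; auto)+

lemma elementary_ends:
  assumes "elementary_homotopy M X \<beta> \<gamma>"
  shows "gallery M X \<beta>" "gallery M X \<gamma>" "fst \<beta> = fst \<gamma>" "terminal X \<beta> = terminal X \<gamma>"
proof -
  have "gallery M X \<beta> \<and> gallery M X \<gamma> \<and> fst \<beta> = fst \<gamma> \<and> terminal X \<beta> = terminal X \<gamma>"
    using assms
  proof cases
    case (delete_inverse C us i vs)
    then show ?thesis
      by (auto simp: gallery_from_append[OF cs] edge_inv_simps[OF cs])
  next
    case (compose C us i j vs)
    then show ?thesis
      by (auto simp: gallery_from_append[OF cs] edge_comp_simps[OF cs] edge_comp_edges)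
  next
    case (delete_suite C us es vs s t D)
    then show ?thesis
      using suite_cycle_at[OF delete_suite(4,5), of "terminal X (C, us)"]
      by (auto simp: gallery_from_append[OF cs])
  qed
  then show "gallery M X \<beta>" "gallery M X \<gamma>" "fst \<beta> = fst \<gamma>" "terminal X \<beta> = terminal X \<gamma>"
    by auto
qed

lemma elementary_imp_homotopic: "elementary_homotopy M X \<beta> \<gamma> \<Longrightarrow> homotopic M X \<beta> \<gamma>"
  using elementary_ends by (auto simp: homotopic_def)

lemma homotopic_refl: "gallery M X \<beta> \<Longrightarrow> homotopic M X \<beta> \<beta>"
  by (simp add: homotopic_def)

lemma homotopic_sym: "homotopic M X \<beta> \<gamma> \<Longrightarrow> homotopic M X \<gamma> \<beta>"
  by (auto simp: homotopic_def intro: equivclp_sym)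

lemma homotopic_trans [trans]:
  "homotopic M X \<beta> \<gamma> \<Longrightarrow> homotopic M X \<gamma> \<delta> \<Longrightarrow> homotopic M X \<beta> \<delta>"
  by (auto simp: homotopic_def intro: equivclp_trans)

lemma homotopic_gallery: "homotopic M X \<beta> \<gamma> \<Longrightarrow> gallery M X \<beta> \<and> gallery M X \<gamma>"
  by (auto simp: homotopic_def)

text \<open>The induction rule of \<open>equivclp\<close> adds one move, in either direction, at the
  end of a chain. Splitting this into symmetry and transitivity means that a property has to be
  checked only for the three moves in their given direction, with all intermediate galleries known
  to be galleries.\<close>

lemma homotopic_induct [consumes 1, case_names refl elementary sym trans]:
  assumes "homotopic M X \<beta> \<gamma>"
    and "\<And>\<beta>. gallery M X \<beta> \<Longrightarrow> P \<beta> \<beta>"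
    and "\<And>\<beta> \<gamma>. elementary_homotopy M X \<beta> \<gamma> \<Longrightarrow> P \<beta> \<gamma>"
    and "\<And>\<beta> \<gamma>. homotopic M X \<beta> \<gamma> \<Longrightarrow> P \<beta> \<gamma> \<Longrightarrow> P \<gamma> \<beta>"
    and "\<And>\<beta> \<gamma> \<delta>. homotopic M X \<beta> \<gamma> \<Longrightarrow> homotopic M X \<gamma> \<delta> \<Longrightarrow> P \<beta> \<gamma> \<Longrightarrow> P \<gamma> \<delta> \<Longrightarrow> P \<beta> \<delta>"
  shows "P \<beta> \<gamma>"
proof -
  have g: "gallery M X \<beta>" and "equivclp (elementary_homotopy M X) \<beta> \<gamma>"
    using assms(1) by (auto simp: homotopic_def)
  from this(2) have "homotopic M X \<beta> \<gamma> \<and> P \<beta> \<gamma>"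
  proof (induction rule: equivclp_induct)
    case base
    then show ?case using g assms(2) homotopic_refl by auto
  next
    case (step \<gamma> \<delta>)
    then have "homotopic M X \<gamma> \<delta> \<and> P \<gamma> \<delta>"
      using assms(3,4) elementary_imp_homotopic homotopic_sym by blast
    then show ?case using step assms(5) homotopic_trans by blast
  qed
  then show ?thesis ..
qed

lemma homotopic_ends:
  "homotopic M X \<beta> \<gamma> \<Longrightarrow> fst \<beta> = fst \<gamma> \<and> terminal X \<beta> = terminal X \<gamma>"
  by (induction rule: homotopic_induct) (auto dest: elementary_ends(3,4))

section \<open>Homotopy as a congruence, and left cancellation\<close>

lemma elementary_context:
  assumes "elementary_homotopy M X (D, es) (D, fs)"
    and "gallery_from M X C (us @ es @ vs)" "terminal X (C, us) = D"
  shows "elementary_homotopy M X (C, us @ es @ vs) (C, us @ fs @ vs)"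
  using assms(1)
proof cases
  case (delete_inverse ps i qs)
  then show ?thesis using assms elementary_homotopy.delete_inverse[of M X C "us @ ps" i "qs @ vs"]
    by simp
next
  case (compose ps i j qs)
  then show ?thesis using assms elementary_homotopy.compose[of M X C "us @ ps" i j "qs @ vs"]
    by simp
next
  case (delete_suite ps gs qs s t D')
  then show ?thesis
    using assms elementary_homotopy.delete_suite[of M X C "us @ ps" gs "qs @ vs" s t D'] by simp
qed

lemma homotopic_context:
  assumes "homotopic M X (D, es) (D, fs)"
    and "gallery_from M X C us" "terminal X (C, us) = D" "gallery_from M X (terminal X (D, es)) vs"
  shows "homotopic M X (C, us @ es @ vs) (C, us @ fs @ vs)"
proof -
  \<comment> \<open>The claim is generalized to arbitrary pairs. The two premises on ends survive
    along a chain because homotopies preserve both ends.\<close>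
  have "fst \<beta> = D \<longrightarrow> terminal X \<beta> = terminal X (D, es) \<longrightarrow>
    homotopic M X (C, us @ snd \<beta> @ vs) (C, us @ snd \<gamma> @ vs)"
    if "homotopic M X \<beta> \<gamma>" for \<beta> \<gamma>
    using that
  proof (induction rule: homotopic_induct)
    case (refl \<beta>)
    then show ?case using assms
      by (cases \<beta>) (auto intro!: homotopic_refl simp: gallery_from_append[OF cs])
  next
    case (elementary \<beta> \<gamma>)
    then show ?case using assms elementary_ends[OF elementary] elementary_context[of D "snd \<beta>" "snd \<gamma>" C us vs]
      by (cases \<beta>, cases \<gamma>) (auto intro!: elementary_imp_homotopic simp: gallery_from_append[OF cs])
  next
    case (sym \<beta> \<gamma>)
    then show ?case using homotopic_sym homotopic_ends[OF sym(1)] by auto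
  next
    case (trans \<beta> \<gamma> \<delta>)
    then show ?case using homotopic_trans homotopic_ends[OF trans(1)] by auto
  qed
  from this[OF assms(1)] show ?thesis by simp
qed

lemma homotopic_inverse:
  assumes "i \<in> edges M X"
  shows "homotopic M X (edge_src X i, [i, edge_inv X i]) (edge_src X i, [])"
proof -
  have "gallery_from M X (edge_src X i) ([] @ [i, edge_inv X i] @ [])"
    using assms by (simp add: edge_inv_simps[OF cs] edge_inv_edges[OF cs] edge_src_chambers[OF cs])
  then show ?thesis
    using elementary_homotopy.delete_inverse[of M X "edge_src X i" "[]" i "[]"]
    by (intro elementary_imp_homotopic) simp
qed

text \<open>Edges are invertible up to homotopy: putting the inverse of the first edge in front of
  both galleries strips that edge, and the prefix \<open>us\<close> disappears one edge at a
  time.\<close>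

lemma homotopic_cancel:
  assumes "homotopic M X (C, us @ es) (C, us @ fs)"
  shows "homotopic M X (terminal X (C, us), es) (terminal X (C, us), fs)"
  using assms
proof (induction us arbitrary: C)
  case (Cons i us)
  let ?D = "edge_tgt X i"
  have i: "i \<in> edges M X" "edge_src X i = C"
    using homotopic_gallery[OF Cons.prems] by auto
  have inv: "edge_inv X i \<in> edges M X" using edge_inv_edges[OF cs i(1)] .
  have *: "homotopic M X (?D, edge_inv X i # i # gs) (?D, gs)" if "gallery_from M X ?D gs" for gs
    using homotopic_context[OF homotopic_inverse[OF inv], of ?D "[]" gs] that i
    by (simp add: edge_inv_simps[OF cs i(1)] edge_tgt_chambers[OF cs])
  have "homotopic M X (?D, us @ es) (?D, edge_inv X i # i # us @ es)"
    using * homotopic_gallery[OF Cons.prems] homotopic_sym by simp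
  also have "homotopic M X \<dots> (?D, edge_inv X i # i # us @ fs)"
    using homotopic_context[OF Cons.prems, of ?D "[edge_inv X i]" "[]"] inv i
      homotopic_gallery[OF Cons.prems] gallery_from_terminal[of M X C "i # us @ es"]
    by (auto simp: edge_inv_simps[OF cs i(1)] edge_src_chambers[OF cs])
  also have "homotopic M X \<dots> (?D, us @ fs)"
    using * homotopic_gallery[OF Cons.prems] by simp
  finally show ?case using Cons.IH by simp
qed simp

text \<open>The source and target of an arrow of the fundamental groupoid are given by
  \<open>the_elem\<close> on the ends of all members of a class. Homotopic galleries share their
  ends, so these sets are singletons and the condition can be checked on galleries.\<close>

lemma simply_connectedI:
  assumes "\<And>C es fs. gallery_from M X C es \<Longrightarrow> gallery_from M X C fs \<Longrightarrow>
    terminal X (C, es) = terminal X (C, fs) \<Longrightarrow> homotopic M X (C, es) (C, fs)"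
  shows "simply_connected M X"
  unfolding simply_connected_def Let_def
proof (intro ballI impI)
  let ?\<Pi> = "fundamental_groupoid M X"
  have repr: "\<exists>\<beta>. gallery M X \<beta> \<and> a = {\<gamma>. homotopic M X \<beta> \<gamma>} \<and> src ?\<Pi> a = fst \<beta> \<and>
    tgt ?\<Pi> a = terminal X \<beta>" if a: "a \<in> arrs ?\<Pi>" for a
  proof -
    obtain \<beta> where \<beta>: "gallery M X \<beta>" "a = {\<gamma>. homotopic M X \<beta> \<gamma>}"
      using a by (auto simp: fundamental_groupoid_def quotient_def)
    have "\<beta> \<in> a" "\<And>\<gamma>. \<gamma> \<in> a \<Longrightarrow> fst \<gamma> = fst \<beta> \<and> terminal X \<gamma> = terminal X \<beta>"
      using \<beta> homotopic_refl homotopic_ends by fastforce+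
    then have "initial ` a = {fst \<beta>}" "terminal X ` a = {terminal X \<beta>}"
      by (force simp: initial_def)+
    then show ?thesis using \<beta> by (intro exI[of _ \<beta>]) (simp add: fundamental_groupoid_def)
  qed
  fix C D a b assume "a \<in> arrs ?\<Pi>" "b \<in> arrs ?\<Pi>"
    and ends: "src ?\<Pi> a = C \<and> tgt ?\<Pi> a = D \<and> src ?\<Pi> b = C \<and> tgt ?\<Pi> b = D"
  from repr[OF this(1)] repr[OF this(2)] ends
  obtain \<beta> \<gamma> where *: "gallery M X \<beta>" "a = {\<delta>. homotopic M X \<beta> \<delta>}"
      "gallery M X \<gamma>" "b = {\<delta>. homotopic M X \<gamma> \<delta>}"
      "fst \<beta> = fst \<gamma>" "terminal X \<beta> = terminal X \<gamma>"
    by auto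
  then have "homotopic M X \<beta> \<gamma>" using assms[of "fst \<beta>" "snd \<beta>" "snd \<gamma>"] by (cases \<beta>, cases \<gamma>) auto
  then have "homotopic M X \<beta> \<delta> \<longleftrightarrow> homotopic M X \<gamma> \<delta>" for \<delta>
    by (meson homotopic_sym homotopic_trans)
  then show "a = b" using * by simp
qed

text \<open>(PW0) speaks of arrows, identities included, while a covering controls only edges. This
  turns the condition at \<open>C\<close> into the absence of edges of type \<open>s\<close>, a form
  that can be compared along a covering.\<close>

lemma trivial_panel_iff:
  assumes s: "s \<in> gens M" and C: "C \<in> chambers X"
  shows "trivial_groupoid (component (panel_groupoid X s) C) \<longleftrightarrow>
    (\<forall>i\<in>edges M X. fst i = s \<longrightarrow> edge_src X i \<noteq> C)"
proof
  let ?P = "panel_groupoid X s"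
  interpret P: groupoid ?P using cs s by (simp add: chamber_system_def)
  have v: "verts ?P = chambers X" using cs s by (simp add: chamber_system_def)
  have id: "ident ?P C \<in> arrs ?P" "src ?P (ident ?P C) = C" "tgt ?P (ident ?P C) = C"
    using P.ident_closed P.src_ident P.tgt_ident C v by auto
  show "trivial_groupoid (component ?P C) \<Longrightarrow> \<forall>i\<in>edges M X. fst i = s \<longrightarrow> edge_src X i \<noteq> C"
  proof (intro ballI impI)
    fix i assume tr: "trivial_groupoid (component ?P C)" and i: "i \<in> edges M X" "fst i = s"
    show "edge_src X i \<noteq> C"
    proof
      assume "edge_src X i = C"
      then have "snd i \<in> arrs (component ?P C)" "ident ?P C \<in> arrs (component ?P C)"
        unfolding component_simps using i id edge_arr[OF i(1)] by (auto simp: edge_src_def)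
      moreover obtain g where "arrs (component ?P C) = {g}"
        using tr by (auto simp: trivial_groupoid_def)
      ultimately have "snd i = ident ?P C" by simp
      moreover have "\<forall>D\<in>chambers X. snd i \<noteq> ident ?P D" using i by (auto simp: edges_def)
      ultimately show False using C by simp
    qed
  qed
  assume no: "\<forall>i\<in>edges M X. fst i = s \<longrightarrow> edge_src X i \<noteq> C"
  \<comment> \<open>An arrow that is not an edge is the identity of some chamber, and its source
    forces that chamber to be \<open>C\<close>.\<close>
  have only: "g = ident ?P C" if g: "g \<in> arrs ?P" "src ?P g = C" for g
  proof -
    have "(s, g) \<notin> edges M X" using no g by (auto simp: edge_src_def)
    then obtain D where "D \<in> chambers X" "g = ident ?P D" using g s by (auto simp: edges_def)
    then show ?thesis using g(2) P.src_ident v by metis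
  qed
  have tgt: "tgt ?P g = C" if "g \<in> arrs ?P" "src ?P g = C" for g
    using only[OF that] id(3) by simp
  have "verts (component ?P C) = {C}"
    unfolding component_simps
  proof (intro equalityI subsetI)
    fix w assume "w \<in> {C}"
    then show "w \<in> {w. \<exists>g\<in>arrs ?P. src ?P g = C \<and> tgt ?P g = w}"
      using id by blast
  qed (use tgt in auto)
  moreover have "arrs (component ?P C) = {ident ?P C}"
    unfolding component_simps
  proof (intro equalityI subsetI)
    fix g assume "g \<in> {g \<in> arrs ?P. \<exists>h\<in>arrs ?P. src ?P h = C \<and> tgt ?P h = src ?P g}"
    then have "g \<in> arrs ?P" "src ?P g = C" using tgt by auto
    then show "g \<in> {ident ?P C}" using only[of g] by simp
  next
    fix g assume "g \<in> {ident ?P C}"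
    then show "g \<in> {g \<in> arrs ?P. \<exists>h\<in>arrs ?P. src ?P h = C \<and> tgt ?P h = src ?P g}"
      using id by auto
  qed
  ultimately show "trivial_groupoid (component ?P C)" unfolding trivial_groupoid_def by blast
qed

lemma no_trivial_panel_iff:
  "(\<forall>P\<in>panels M X. \<not> trivial_groupoid P) \<longleftrightarrow>
   (\<forall>s\<in>gens M. \<forall>C\<in>chambers X. \<exists>i\<in>edges M X. fst i = s \<and> edge_src X i = C)"
proof -
  have "(\<forall>P\<in>panels M X. \<not> trivial_groupoid P) \<longleftrightarrow>
    (\<forall>s\<in>gens M. \<forall>C\<in>chambers X. \<not> trivial_groupoid (component (panel_groupoid X s) C))"
    unfolding panels_def by auto
  then show ?thesis using trivial_panel_iff by simp
qed

end

section \<open>Lifting homotopies to a covering\<close>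

text \<open>A suite is by definition homotopic to the trivial gallery at some chamber; preservation
  of initial chambers forces that chamber to be \<open>D\<close>.\<close>

lemma suite_imp_homotopic:
  assumes "weyl M Z" "suite M Z (D, es)"
  shows "homotopic M Z (D, es) (D, [])"
  using assms(2) weyl.homotopic_ends[OF assms(1), of "(D, es)"]
  by (fastforce simp: suite_def trivial_gallery_def)

locale weyl_covering =
  fixes M :: "'s coxeter" and X :: "('s, 'c, 'e) weyl_data" and Y :: "('s, 'd, 'f) weyl_data"
    and p :: "('s, 'c, 'e, 'd, 'f) morphism"
  assumes covering: "covering M X Y p"
begin

sublocale X: weyl M X
  using covering by unfold_locales (simp add: covering_def)

sublocale Y: weyl M Y
  using covering by unfold_locales (simp add: covering_def)

lemma morphism: "chamber_system_morphism M X Y p"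
  using covering by (simp add: covering_def weyl_data_morphism_def)

lemma etale: "surjective_etale M X Y p"
  using covering by (simp add: covering_def)

lemma suite_lift:
  "spherical_pair M s t \<Longrightarrow> gallery M X \<beta> \<Longrightarrow> image_gallery p \<beta> \<in> defining_suites Y s t \<Longrightarrow> suite M X \<beta>"
  using covering unfolding covering_def by blast

lemma on_chambers_image: "on_chambers p ` chambers X = chambers Y"
  using etale by (simp add: surjective_etale_def)

lemma edge_images:
  assumes "i \<in> edges M X"
  shows "on_edges p i \<in> edges M Y" "fst (on_edges p i) = fst i"
    "edge_src Y (on_edges p i) = on_chambers p (edge_src X i)"
    "edge_tgt Y (on_edges p i) = on_chambers p (edge_tgt X i)"
    "on_edges p (edge_inv X i) = edge_inv Y (on_edges p i)"
  using morphism assms by (simp_all add: chamber_system_morphism_def)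

lemma edge_comp_image:
  "i \<in> edges M X \<Longrightarrow> j \<in> edges M X \<Longrightarrow> fst i = fst j \<Longrightarrow> edge_tgt X i = edge_src X j \<Longrightarrow>
   j \<noteq> edge_inv X i \<Longrightarrow> on_edges p (edge_comp X i j) = edge_comp Y (on_edges p i) (on_edges p j)"
  using morphism by (simp add: chamber_system_morphism_def)

lemma on_edges_inj:
  assumes "i \<in> edges M X" "j \<in> edges M X" "edge_src X i = edge_src X j" "on_edges p i = on_edges p j"
  shows "i = j"
proof -
  have "inj_on (on_edges p) {k \<in> edges M X. edge_src X k = edge_src X i}"
    using etale edge_src_chambers[OF X.cs assms(1)] by (simp add: surjective_etale_def bij_betw_def)
  then show ?thesis using assms by (auto dest: inj_onD)
qed

lemma edge_lift:
  assumes "C \<in> chambers X" "j \<in> edges M Y" "edge_src Y j = on_chambers p C"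
  obtains i where "i \<in> edges M X" "edge_src X i = C" "on_edges p i = j"
proof -
  have "j \<in> on_edges p ` {i \<in> edges M X. edge_src X i = C}"
    using etale assms by (simp add: surjective_etale_def bij_betw_def)
  then show ?thesis using that by auto
qed

lemma gallery_lift:
  "C \<in> chambers X \<Longrightarrow> gallery_from M Y (on_chambers p C) es \<Longrightarrow>
   \<exists>fs. gallery_from M X C fs \<and> map (on_edges p) fs = es"
proof (induction es arbitrary: C)
  case (Cons j es)
  then obtain i where i: "i \<in> edges M X" "edge_src X i = C" "on_edges p i = j"
    using edge_lift[of C j] by (metis gallery_from.simps(2))
  have "gallery_from M Y (on_chambers p (edge_tgt X i)) es"
    using Cons.prems i edge_images(4)[OF i(1)] by simp
  then obtain fs where "gallery_from M X (edge_tgt X i) fs" "map (on_edges p) fs = es"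
    using Cons.IH[OF edge_tgt_chambers[OF X.cs i(1)]] by blast
  then show ?case using i by (intro exI[of _ "i # fs"]) auto
qed simp

lemmas gallery_lift_unique = etale_unique_lift[OF X.cs etale morphism]

lemma terminal_image:
  "gallery_from M X C es \<Longrightarrow>
   terminal Y (on_chambers p C, map (on_edges p) es) = on_chambers p (terminal X (C, es))"
  using morphism_terminal[OF morphism, of "(C, es)"] by (simp add: image_gallery_def)

lemma gallery_image:
  "gallery_from M X C es \<Longrightarrow> gallery_from M Y (on_chambers p C) (map (on_edges p) es)"
  by (rule morphism_gallery_from[OF morphism])

text \<open>The first two moves project to moves of the same kind. The third gives only a homotopy,
  since a morphism sends a defining suite to a suite, which must then be contracted in its
  context.\<close>

lemma elementary_image:
  assumes "elementary_homotopy M X \<beta> \<gamma>"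
  shows "homotopic M Y (image_gallery p \<beta>) (image_gallery p \<gamma>)"
  using assms
proof cases
  case (delete_inverse C us i vs)
  have i: "i \<in> edges M X" using delete_inverse(3) by (auto simp: gallery_from_append[OF X.cs])
  show ?thesis
    using elementary_homotopy.delete_inverse[of M Y "on_chambers p C" "map (on_edges p) us" "on_edges p i" "map (on_edges p) vs"]
      gallery_image[of C "us @ [i, edge_inv X i] @ vs"] delete_inverse
    by (intro Y.elementary_imp_homotopic) (simp add: image_gallery_def edge_images[OF i])
next
  case (compose C us i j vs)
  have ij: "i \<in> edges M X" "j \<in> edges M X" "edge_tgt X i = edge_src X j"
    using compose(3) by (auto simp: gallery_from_append[OF X.cs])
  \<comment> \<open>Both \<open>j\<close> and the inverse of \<open>i\<close> issue from
    \<open>edge_tgt X i\<close>, where \<open>p\<close> is injective on edges; so a composition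
    cannot turn into a cancellation in the image.\<close>
  have "on_edges p j \<noteq> edge_inv Y (on_edges p i)"
    using on_edges_inj[OF ij(2) edge_inv_edges[OF X.cs ij(1)]] compose ij
    by (auto simp: edge_images edge_inv_simps[OF X.cs])
  then show ?thesis
    using elementary_homotopy.compose[of M Y "on_chambers p C" "map (on_edges p) us" "on_edges p i" "on_edges p j" "map (on_edges p) vs"]
      gallery_image[of C "us @ [i, j] @ vs"] compose ij
    by (intro Y.elementary_imp_homotopic) (simp add: image_gallery_def edge_images edge_comp_image)
next
  case (delete_suite C us es vs s t D)
  let ?E = "terminal X (C, us)"
  have g: "gallery_from M X C us" "gallery_from M X ?E es" "gallery_from M X (terminal X (?E, es)) vs"
    using delete_suite(3) by (auto simp: gallery_from_append[OF X.cs])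
  have "homotopic M Y (on_chambers p D, map (on_edges p) es) (on_chambers p D, [])"
    using covering delete_suite suite_imp_homotopic[OF Y.weyl_axioms, of "on_chambers p D" "map (on_edges p) es"]
    by (fastforce simp: covering_def weyl_data_morphism_def image_gallery_def)
  then have h: "homotopic M Y (on_chambers p ?E, map (on_edges p) es) (on_chambers p ?E, [])"
    using X.suite_cycle_at(2)[OF delete_suite(4,5) g(2)] gallery_image[OF g(2)] Y.homotopic_refl
    by (cases "es = []") auto
  show ?thesis
    using Y.homotopic_context[OF h gallery_image[OF g(1)] _, of "map (on_edges p) vs"]
      terminal_image g gallery_image delete_suite by (simp add: image_gallery_def)
qed

lemma homotopic_image:
  assumes "homotopic M X \<beta> \<gamma>"
  shows "homotopic M Y (image_gallery p \<beta>) (image_gallery p \<gamma>)"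
  using assms
proof (induction rule: X.homotopic_induct)
  case (refl \<beta>)
  then show ?case by (intro Y.homotopic_refl morphism_gallery[OF morphism])
qed (auto intro: elementary_image Y.homotopic_sym Y.homotopic_trans)

text \<open>A move on the projection of \<open>es\<close> affects a segment that is matched by a
  segment of \<open>es\<close>. Injectivity of \<open>p\<close> at a chamber recognizes lifted
  inverse pairs, and the covering axiom makes a lifted defining suite a suite, hence contractible.
  Only the shortening direction is treated.\<close>

lemma elementary_lift:
  assumes h: "elementary_homotopy M Y (on_chambers p C, map (on_edges p) es) \<gamma>"
    and es: "gallery_from M X C es"
  shows "\<exists>fs. gallery_from M X C fs \<and> map (on_edges p) fs = snd \<gamma> \<and> homotopic M X (C, es) (C, fs)"
  using h
proof cases
  case (delete_inverse us i vs)
  then obtain us' a b vs' where es': "es = us' @ [a, b] @ vs'" "map (on_edges p) us' = us"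
      "on_edges p a = i" "on_edges p b = edge_inv Y i" "map (on_edges p) vs' = vs"
    by (auto simp: map_eq_append_conv map_eq_Cons_conv)
  have ab: "a \<in> edges M X" "b \<in> edges M X" "edge_src X b = edge_tgt X a"
    using es es' by (auto simp: gallery_from_append[OF X.cs])
  have "b = edge_inv X a"
    using es'(3,4) ab
    by (intro on_edges_inj edge_inv_edges[OF X.cs]) (simp_all add: edge_images edge_inv_simps[OF X.cs])
  then have "elementary_homotopy M X (C, es) (C, us' @ vs')"
    using elementary_homotopy.delete_inverse[of M X C us' a vs'] es es' by simp
  from X.elementary_ends(2)[OF this] X.elementary_imp_homotopic[OF this]
  show ?thesis using es' delete_inverse by (intro exI[of _ "us' @ vs'"]) simp
next
  case (compose us i j vs)
  then obtain us' a b vs' where es': "es = us' @ [a, b] @ vs'" "map (on_edges p) us' = us"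
      "on_edges p a = i" "on_edges p b = j" "map (on_edges p) vs' = vs"
    by (auto simp: map_eq_append_conv map_eq_Cons_conv)
  have ab: "a \<in> edges M X" "b \<in> edges M X" "edge_tgt X a = edge_src X b"
    using es es' by (auto simp: gallery_from_append[OF X.cs])
  have ne: "b \<noteq> edge_inv X a"
    using compose(5) es'(3,4) edge_images(5)[OF ab(1)] by metis
  have s: "fst a = fst b"
    using compose(4) es'(3,4) edge_images(2)[OF ab(1)] edge_images(2)[OF ab(2)] by simp
  have "elementary_homotopy M X (C, es) (C, us' @ [edge_comp X a b] @ vs')"
    using elementary_homotopy.compose[of M X C us' a b vs'] es es' ne s by simp
  from X.elementary_ends(2)[OF this] X.elementary_imp_homotopic[OF this]
  show ?thesis using es' compose edge_comp_image[OF ab(1,2) s ab(3) ne]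
    by (intro exI[of _ "us' @ [edge_comp X a b] @ vs'"]) simp
next
  case (delete_suite us gs vs s t D')
  then have "map (on_edges p) es = us @ gs @ vs" by simp
  from map_eq_append_conv[THEN iffD1, OF this] obtain us' ws'
    where ws': "es = us' @ ws'" "us = map (on_edges p) us'" "gs @ vs = map (on_edges p) ws'"
    by blast
  from map_eq_append_conv[THEN iffD1, OF ws'(3)[symmetric]] obtain gs' vs'
    where "ws' = gs' @ vs'" "gs = map (on_edges p) gs'" "vs = map (on_edges p) vs'"
    by blast
  with ws' have es': "es = us' @ gs' @ vs'" "map (on_edges p) us' = us"
      "map (on_edges p) gs' = gs" "map (on_edges p) vs' = vs"
    by simp_all
  let ?E = "terminal X (C, us')"
  have g: "gallery_from M X C us'" "gallery_from M X ?E gs'" "gallery_from M X (terminal X (?E, gs')) vs'"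
    using es es' by (auto simp: gallery_from_append[OF X.cs])
  have h: "homotopic M X (?E, gs') (?E, [])"
  proof (cases "gs' = []")
    case False
    \<comment> \<open>Nonemptiness identifies the recorded base \<open>D'\<close> with the image of
      \<open>?E\<close>, so the lifted segment projects exactly to the defining suite.\<close>
    have "image_gallery p (?E, gs') = (D', gs)"
      using Y.suite_cycle_at(2)[OF delete_suite(4,5), of "on_chambers p ?E"] gallery_image[OF g(2)]
        es' False by (auto simp: image_gallery_def)
    then have "suite M X (?E, gs')"
      using suite_lift[OF delete_suite(4), of "(?E, gs')"] delete_suite(5) g(2) by simp
    then show ?thesis by (rule suite_imp_homotopic[OF X.weyl_axioms])
  next
    case True
    then show ?thesis using g X.homotopic_refl by simp
  qed
  from X.homotopic_context[OF h g(1) _ g(3)] have "homotopic M X (C, es) (C, us' @ vs')"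
    using es' by simp
  with X.homotopic_gallery[OF this] show ?thesis using es' delete_suite
    by (intro exI[of _ "us' @ vs'"]) simp
qed

text \<open>The induction claim quantifies over all lifts of both galleries from a common chamber.
  In this form it is symmetric, which settles the inverse moves; uniqueness of lifts identifies the
  gallery found by \<open>elementary_lift\<close> with the prescribed \<open>fs\<close>.\<close>

lemma homotopic_lift:
  assumes "gallery_from M X C es" "gallery_from M X C fs"
    and h: "homotopic M Y (on_chambers p C, map (on_edges p) es) (on_chambers p C, map (on_edges p) fs)"
  shows "homotopic M X (C, es) (C, fs)"
proof -
  have "\<forall>C es fs. fst \<beta> = on_chambers p C \<longrightarrow> gallery_from M X C es \<longrightarrow> gallery_from M X C fs \<longrightarrow>
    snd \<beta> = map (on_edges p) es \<longrightarrow> snd \<gamma> = map (on_edges p) fs \<longrightarrow> homotopic M X (C, es) (C, fs)"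
    if "homotopic M Y \<beta> \<gamma>" for \<beta> \<gamma>
    using that
  proof (induction rule: Y.homotopic_induct)
    case (refl \<beta>)
    show ?case
    proof (intro allI impI)
      fix C es fs
      assume *: "gallery_from M X C es" "gallery_from M X C fs"
        "snd \<beta> = map (on_edges p) es" "snd \<beta> = map (on_edges p) fs"
      then have "es = fs" using gallery_lift_unique[of C es fs] by simp
      then show "homotopic M X (C, es) (C, fs)" using * X.homotopic_refl by simp
    qed
  next
    case (elementary \<beta> \<gamma>)
    show ?case
    proof (intro allI impI)
      fix C es fs
      assume *: "fst \<beta> = on_chambers p C" "gallery_from M X C es" "gallery_from M X C fs"
        "snd \<beta> = map (on_edges p) es" "snd \<gamma> = map (on_edges p) fs"
      then have "\<beta> = (on_chambers p C, map (on_edges p) es)" by (simp add: prod_eq_iff)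
      then obtain gs where gs: "gallery_from M X C gs" "map (on_edges p) gs = snd \<gamma>"
        "homotopic M X (C, es) (C, gs)"
        using elementary_lift[OF _ *(2)] elementary by blast
      then have "gs = fs" using gallery_lift_unique[of C gs fs] * by simp
      then show "homotopic M X (C, es) (C, fs)" using gs by simp
    qed
  next
    case (sym \<beta> \<gamma>)
    then show ?case using X.homotopic_sym Y.homotopic_ends[OF sym(1)] by auto
  next
    case (trans \<beta> \<gamma> \<delta>)
    show ?case
    proof (intro allI impI)
      fix C es fs
      assume *: "fst \<beta> = on_chambers p C" "gallery_from M X C es" "gallery_from M X C fs"
        "snd \<beta> = map (on_edges p) es" "snd \<delta> = map (on_edges p) fs"
      \<comment> \<open>The middle gallery comes without a lift; it starts at the image of
        \<open>C\<close>, so one can be chosen from \<open>C\<close>.\<close>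
      have \<gamma>: "fst \<gamma> = on_chambers p C" "gallery_from M Y (fst \<gamma>) (snd \<gamma>)"
        using Y.homotopic_ends[OF trans(1)] Y.homotopic_gallery[OF trans(1)] *
        by (auto simp: gallery_def)
      then obtain gs where gs: "gallery_from M X C gs" "map (on_edges p) gs = snd \<gamma>"
        using gallery_lift[OF gallery_from_initial[OF X.cs *(2)], of "snd \<gamma>"] by auto
      have "homotopic M X (C, es) (C, gs)" using trans(3) * gs by simp
      moreover have "homotopic M X (C, gs) (C, fs)" using trans(4) * gs \<gamma> by simp
      ultimately show "homotopic M X (C, es) (C, fs)" by (rule X.homotopic_trans)
    qed
  qed
  from this[OF h] assms show ?thesis by simp
qed

section \<open>Transfer of the Weyl graph conditions and of connectedness\<close>

lemma covering_gallery:
  assumes "gallery M Y \<beta>" "C \<in> chambers X" "fst \<beta> = on_chambers p C"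
  obtains es where "gallery_from M X C es" "image_gallery p (C, es) = \<beta>"
    "gtype (C, es) = gtype \<beta>"
proof -
  obtain es where es: "gallery_from M X C es" "map (on_edges p) es = snd \<beta>"
    using gallery_lift[of C "snd \<beta>"] assms by (auto simp: gallery_def)
  then have "image_gallery p (C, es) = \<beta>"
    using assms by (simp add: image_gallery_def prod_eq_iff)
  then show ?thesis using that es morphism_gtype[OF morphism, of "(C, es)"] by simp
qed

lemma panels_nontrivial_iff:
  "(\<forall>P\<in>panels M X. \<not> trivial_groupoid P) \<longleftrightarrow> (\<forall>P\<in>panels M Y. \<not> trivial_groupoid P)"
  unfolding X.no_trivial_panel_iff Y.no_trivial_panel_iff
proof (intro iffI ballI)
  fix s D assume *: "\<forall>s\<in>gens M. \<forall>C\<in>chambers X. \<exists>i\<in>edges M X. fst i = s \<and> edge_src X i = C"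
    "s \<in> gens M" "D \<in> chambers Y"
  then obtain C where "C \<in> chambers X" "D = on_chambers p C" using on_chambers_image by (metis imageE)
  then show "\<exists>i\<in>edges M Y. fst i = s \<and> edge_src Y i = D"
    using * edge_images by metis
next
  fix s C assume *: "\<forall>s\<in>gens M. \<forall>C\<in>chambers Y. \<exists>i\<in>edges M Y. fst i = s \<and> edge_src Y i = C"
    "s \<in> gens M" "C \<in> chambers X"
  then have "on_chambers p C \<in> chambers Y" using on_chambers_image by auto
  then obtain j where "j \<in> edges M Y" "fst j = s" "edge_src Y j = on_chambers p C" using * by metis
  then show "\<exists>i\<in>edges M X. fst i = s \<and> edge_src X i = C"
    using edge_lift[OF *(3)] edge_images by metis
qed

text \<open>Lifting is needed for (PW1): the partner geodesic found in \<open>Y\<close> is lifted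
  from the start of \<open>\<beta>\<close>, together with the homotopy. For (W) it is enough to
  project, as types are preserved.\<close>

lemma weyl_graph_lift:
  assumes "weyl_graph M Y"
  shows "weyl_graph M X"
proof -
  have pw1: "\<exists>\<gamma>. maximal_geodesic M X t s \<gamma> \<and> homotopic M X \<beta> \<gamma>"
    if st: "spherical_pair M s t" and \<beta>: "maximal_geodesic M X s t \<beta>" for s t \<beta>
  proof -
    have g: "gallery M X \<beta>" using \<beta> by (simp add: maximal_geodesic_def)
    have "maximal_geodesic M Y s t (image_gallery p \<beta>)"
      using \<beta> morphism_gallery[OF morphism g] morphism_gtype[OF morphism g]
      by (simp add: maximal_geodesic_def)
    then obtain \<gamma> where \<gamma>: "maximal_geodesic M Y t s \<gamma>" "homotopic M Y (image_gallery p \<beta>) \<gamma>"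
      using assms st unfolding weyl_graph_def pre_weyl_graph_def by blast
    have "fst \<beta> \<in> chambers X" "fst \<gamma> = on_chambers p (fst \<beta>)"
      using g gallery_from_initial[OF X.cs] Y.homotopic_ends[OF \<gamma>(2)]
      by (auto simp: gallery_def image_gallery_def)
    with covering_gallery[OF conjunct2[OF Y.homotopic_gallery[OF \<gamma>(2)]] this]
    obtain es where es: "gallery_from M X (fst \<beta>) es" "image_gallery p (fst \<beta>, es) = \<gamma>"
        "gtype (fst \<beta>, es) = gtype \<gamma>" by blast
    then have "homotopic M X (fst \<beta>, snd \<beta>) (fst \<beta>, es)"
      using g \<gamma>(2) by (intro homotopic_lift) (auto simp: gallery_def image_gallery_def)
    then show ?thesis using es \<gamma>(1)
      by (intro exI[of _ "(fst \<beta>, es)"]) (simp add: maximal_geodesic_def)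
  qed
  have "W_length M \<beta> = W_length M \<gamma>"
    if "geodesic M X \<beta>" "geodesic M X \<gamma>" "homotopic M X \<beta> \<gamma>" for \<beta> \<gamma>
  proof -
    have g: "gallery M X \<beta>" "gallery M X \<gamma>" using that by (auto simp: geodesic_def)
    note gtypes = g[THEN morphism_gtype[OF morphism]]
    have "geodesic M Y (image_gallery p \<beta>)" "geodesic M Y (image_gallery p \<gamma>)"
      using that g[THEN morphism_gallery[OF morphism]] gtypes by (simp_all add: geodesic_def)
    then have "W_length M (image_gallery p \<beta>) = W_length M (image_gallery p \<gamma>)"
      using assms homotopic_image[OF that(3)] unfolding weyl_graph_def by blast
    then show ?thesis using gtypes by (simp add: W_length_def)
  qed
  then show ?thesis
    using assms pw1 X.X panels_nontrivial_iff unfolding weyl_graph_def pre_weyl_graph_def by blast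
qed

text \<open>The roles are exchanged: for (PW1) the partner found in \<open>X\<close> is projected,
  while for (W) the homotopy between two geodesics is lifted to galleries with a common
  start.\<close>

lemma weyl_graph_image:
  assumes "weyl_graph M X"
  shows "weyl_graph M Y"
proof -
  have lift: "\<exists>C. C \<in> chambers X \<and> fst \<beta> = on_chambers p C" if "gallery M Y \<beta>" for \<beta>
    using that gallery_from_initial[OF Y.cs] on_chambers_image by (fastforce simp: gallery_def)
  have pw1: "\<exists>\<gamma>. maximal_geodesic M Y t s \<gamma> \<and> homotopic M Y \<beta> \<gamma>"
    if st: "spherical_pair M s t" and \<beta>: "maximal_geodesic M Y s t \<beta>" for s t \<beta>
  proof -
    have g: "gallery M Y \<beta>" using \<beta> by (simp add: maximal_geodesic_def)
    then obtain C where C: "C \<in> chambers X" "fst \<beta> = on_chambers p C" using lift by blast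
    obtain es where es: "gallery_from M X C es" "image_gallery p (C, es) = \<beta>"
        "gtype (C, es) = gtype \<beta>"
      by (rule covering_gallery[OF g C])
    then have "maximal_geodesic M X s t (C, es)" using \<beta> by (simp add: maximal_geodesic_def)
    then obtain \<gamma> where \<gamma>: "maximal_geodesic M X t s \<gamma>" "homotopic M X (C, es) \<gamma>"
      using assms st unfolding weyl_graph_def pre_weyl_graph_def by blast
    have g': "gallery M X \<gamma>" using \<gamma>(1) by (simp add: maximal_geodesic_def)
    have "maximal_geodesic M Y t s (image_gallery p \<gamma>)"
      using \<gamma>(1) morphism_gallery[OF morphism g'] morphism_gtype[OF morphism g']
      by (simp add: maximal_geodesic_def)
    then show ?thesis using homotopic_image[OF \<gamma>(2)] es(2) by (intro exI[of _ "image_gallery p \<gamma>"]) simp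
  qed
  have "W_length M \<beta> = W_length M \<gamma>"
    if g: "geodesic M Y \<beta>" "geodesic M Y \<gamma>" and h: "homotopic M Y \<beta> \<gamma>" for \<beta> \<gamma>
  proof -
    obtain C where C: "C \<in> chambers X" "fst \<beta> = on_chambers p C"
      using lift[OF conjunct1[OF Y.homotopic_gallery[OF h]]] by blast
    then have C': "fst \<gamma> = on_chambers p C" using Y.homotopic_ends[OF h] by simp
    obtain es where es: "gallery_from M X C es" "image_gallery p (C, es) = \<beta>"
        "gtype (C, es) = gtype \<beta>"
      by (rule covering_gallery[OF _ C]) (use Y.homotopic_gallery[OF h] in auto)
    obtain fs where fs: "gallery_from M X C fs" "image_gallery p (C, fs) = \<gamma>"
        "gtype (C, fs) = gtype \<gamma>"
      by (rule covering_gallery[OF _ C(1) C']) (use Y.homotopic_gallery[OF h] in auto)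
    note * = es fs
    then have "homotopic M X (C, es) (C, fs)"
      using h by (intro homotopic_lift) (auto simp: image_gallery_def)
    moreover have "geodesic M X (C, es)" "geodesic M X (C, fs)"
      using g * by (simp_all add: geodesic_def)
    ultimately have "W_length M (C, es) = W_length M (C, fs)"
      using assms unfolding weyl_graph_def by blast
    then show ?thesis using * by (simp add: W_length_def)
  qed
  then show ?thesis
    using assms pw1 Y.X panels_nontrivial_iff unfolding weyl_graph_def pre_weyl_graph_def by blast
qed

lemma connected_image:
  assumes "connected_system M X"
  shows "connected_system M Y"
  unfolding connected_system_def
proof (intro ballI)
  fix C D assume "C \<in> chambers Y" "D \<in> chambers Y"
  then obtain C' D' where CD: "C' \<in> chambers X" "C = on_chambers p C'"
      "D' \<in> chambers X" "D = on_chambers p D'"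
    unfolding on_chambers_image[symmetric] by blast
  then obtain \<beta> where \<beta>: "gallery M X \<beta>" "initial \<beta> = C'" "terminal X \<beta> = D'"
    using assms unfolding connected_system_def by metis
  have "initial (image_gallery p \<beta>) = C"
    using CD \<beta>(2) by (simp add: initial_def image_gallery_def)
  then show "\<exists>\<beta>. gallery M Y \<beta> \<and> initial \<beta> = C \<and> terminal Y \<beta> = D"
    using CD \<beta> morphism_gallery[OF morphism] morphism_terminal[OF morphism] by blast
qed

end

section \<open>The covering by homotopy classes of galleries\<close>

context weyl
begin

text \<open>The tail followed by its inverse contracts between the first edge \<open>i\<close> and
  \<open>edge_inv X i\<close>, and the remaining pair cancels.\<close>

lemma inverse_gallery_exists:
  "gallery_from M X C es \<Longrightarrow>
   \<exists>fs. gallery_from M X C (es @ fs) \<and> homotopic M X (C, es @ fs) (C, [])"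
proof (induction es arbitrary: C)
  case Nil
  then show ?case by (intro exI[of _ "[]"]) (simp add: homotopic_refl)
next
  case (Cons i es)
  then have i: "i \<in> edges M X" "edge_src X i = C" by auto
  from Cons obtain fs where fs: "homotopic M X (edge_tgt X i, es @ fs) (edge_tgt X i, [])"
    by auto
  then have t: "terminal X (edge_tgt X i, es @ fs) = edge_tgt X i"
    using homotopic_ends by fastforce
  have "homotopic M X (C, [i] @ (es @ fs) @ [edge_inv X i]) (C, [i] @ [] @ [edge_inv X i])"
    using i fs t by (intro homotopic_context)
      (auto simp: edge_tgt_chambers[OF cs] edge_inv_edges[OF cs] edge_inv_simps[OF cs] edge_src_chambers[OF cs])
  also have "homotopic M X \<dots> (C, [])"
    using homotopic_inverse[OF i(1)] i by simp
  finally have "homotopic M X (C, (i # es) @ fs @ [edge_inv X i]) (C, [])" by simp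
  with homotopic_gallery[OF this] show ?case by auto
qed

lemma defining_suite_homotopic:
  assumes "spherical_pair M s t" "(D, es) \<in> defining_suites X s t"
  shows "homotopic M X (D, es) (D, [])"
  using elementary_homotopy.delete_suite[of M X D "[]" es "[]" s t D] suite_cycle[OF assms] assms
  by (intro elementary_imp_homotopic) simp

lemma defining_suite_suite:
  assumes "spherical_pair M s t" "\<beta> \<in> defining_suites X s t"
  shows "suite M X \<beta>"
proof -
  have "st_cycle M X s t \<beta>" using X assms by (simp add: weyl_data_def)
  moreover have "homotopic M X \<beta> (trivial_gallery (fst \<beta>))"
    using defining_suite_homotopic[OF assms(1), of "fst \<beta>" "snd \<beta>"] assms(2)
    by (simp add: trivial_gallery_def)
  moreover have "fst \<beta> \<in> chambers X"
    using gallery_from_initial[OF cs] calculation(1) by (auto simp: st_cycle_def gallery_def)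
  ultimately show ?thesis using assms(1) unfolding suite_def by blast
qed

text \<open>Identity arrows of a panel groupoid are not edges, so they become the empty word.\<close>

definition arrow_word :: "'s \<Rightarrow> 'e \<Rightarrow> ('s, 'e) edge list" where
  "arrow_word s e = (if (s, e) \<in> edges M X then [(s, e)] else [])"

section \<open>Arrows of a panel groupoid as words, up to homotopy\<close>

context
  fixes s
  assumes s: "s \<in> gens M"
begin

lemma panel: "groupoid (panel_groupoid X s)" "verts (panel_groupoid X s) = chambers X"
  using cs s by (simp_all add: chamber_system_def)

lemma not_edge_ident:
  assumes "e \<in> arrs (panel_groupoid X s)" "(s, e) \<notin> edges M X"
  shows "e = ident (panel_groupoid X s) (src (panel_groupoid X s) e)"
    "tgt (panel_groupoid X s) e = src (panel_groupoid X s) e"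
proof -
  obtain C where C: "C \<in> chambers X" "e = ident (panel_groupoid X s) C"
    using assms s by (auto simp: edges_def)
  then have "src (panel_groupoid X s) e = C" "tgt (panel_groupoid X s) e = C"
    using groupoid.src_ident[OF panel(1)] groupoid.tgt_ident[OF panel(1)] panel(2) by auto
  then show "e = ident (panel_groupoid X s) (src (panel_groupoid X s) e)"
    "tgt (panel_groupoid X s) e = src (panel_groupoid X s) e" using C by simp_all
qed

lemma arrow_word_ident: "C \<in> chambers X \<Longrightarrow> arrow_word s (ident (panel_groupoid X s) C) = []"
  by (auto simp: arrow_word_def edges_def)

lemma arrow_word_gallery:
  assumes "e \<in> arrs (panel_groupoid X s)"
  shows "gallery_from M X (src (panel_groupoid X s) e) (arrow_word s e)"
    "terminal X (src (panel_groupoid X s) e, arrow_word s e) = tgt (panel_groupoid X s) e"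
  using groupoid.src_closed[OF panel(1) assms] groupoid.tgt_closed[OF panel(1) assms] panel(2)
    not_edge_ident(2)[OF assms]
  by (auto simp: arrow_word_def edge_src_def edge_tgt_def)

text \<open>\<open>arrow_word\<close> is functorial from the panel groupoid to the fundamental
  groupoid. Identities contribute nothing, inverse edges are cancelled by the first move and other
  pairs are merged by the second; this makes targets in the covering compatible with
  composition.\<close>

lemma arrow_word_comp:
  assumes e: "e \<in> arrs (panel_groupoid X s)" and f: "f \<in> arrs (panel_groupoid X s)"
    and c: "tgt (panel_groupoid X s) e = src (panel_groupoid X s) f"
  shows "homotopic M X (src (panel_groupoid X s) e, arrow_word s e @ arrow_word s f)
    (src (panel_groupoid X s) e, arrow_word s (gcomp (panel_groupoid X s) e f))"
proof -
  let ?P = "panel_groupoid X s"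
  interpret P: groupoid ?P by (rule panel(1))
  have src: "src ?P e \<in> chambers X" using P.src_closed[OF e] panel(2) by simp
  consider "(s, e) \<notin> edges M X" | "(s, f) \<notin> edges M X" | "(s, e) \<in> edges M X" "(s, f) \<in> edges M X"
    by blast
  then show ?thesis
  proof cases
    case 1
    then have "arrow_word s e = []" "gcomp ?P e f = f" "src ?P e = src ?P f"
      using not_edge_ident[OF e] P.ident_comp[OF f] c by (auto simp: arrow_word_def)
    then show ?thesis using arrow_word_gallery[OF f] homotopic_refl by simp
  next
    case 2
    then have "arrow_word s f = []" "gcomp ?P e f = e"
      using not_edge_ident(1)[OF f] P.comp_ident[OF e] c by (auto simp: arrow_word_def)
    then show ?thesis using arrow_word_gallery[OF e] homotopic_refl by simp
  next
    case 3
    let ?i = "(s, e)" and ?j = "(s, f)"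
    have w: "arrow_word s e = [?i]" "arrow_word s f = [?j]" using 3 by (simp_all add: arrow_word_def)
    have st: "edge_src X ?i = src ?P e" "edge_tgt X ?i = edge_src X ?j"
      using c by (simp_all add: edge_src_def edge_tgt_def)
    show ?thesis
    proof (cases "?j = edge_inv X ?i")
      case True
      then have "f = ginv ?P e" by (simp add: edge_inv_def)
      then have "gcomp ?P e f = ident ?P (src ?P e)" using P.comp_inver[OF e] by simp
      then have "arrow_word s (gcomp ?P e f) = []" using arrow_word_ident src by simp
      then show ?thesis using homotopic_inverse[OF 3(1)] True w st by simp
    next
      case False
      have k: "edge_comp X ?i ?j = (s, gcomp ?P e f)" by (simp add: edge_comp_def)
      then have "arrow_word s (gcomp ?P e f) = [edge_comp X ?i ?j]"
        using edge_comp_edges[OF 3 _ st(2) False] by (simp add: arrow_word_def)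
      moreover have "gallery_from M X (src ?P e) [?i, ?j]"
        using 3 st edge_tgt_chambers[OF cs 3(2)] by simp
      ultimately show ?thesis
        using elementary_homotopy.compose[of M X "src ?P e" "[]" ?i ?j "[]"] False w
        by (intro elementary_imp_homotopic) simp
    qed
  qed
qed

end

end

section \<open>Homotopy classes from a base chamber, and the action of galleries on them\<close>

locale path_cover = weyl M Y
  for M :: "'s coxeter" and Y :: "('s, 'c, 'e) weyl_data" +
  fixes C0 :: 'c
  assumes C0: "C0 \<in> chambers Y"
begin

text \<open>All galleries start at \<open>C0\<close>, so a class is kept as a set of edge lists
  without the initial chamber.\<close>

definition cls :: "('s, 'e) edge list \<Rightarrow> ('s, 'e) edge list set" where
  "cls es = {fs. homotopic M Y (C0, es) (C0, fs)}"

definition classes :: "('s, 'e) edge list set set" where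
  "classes = cls ` {es. gallery_from M Y C0 es}"

definition rep :: "('s, 'e) edge list set \<Rightarrow> ('s, 'e) edge list" where
  "rep a = (SOME es. es \<in> a)"

definition end_at :: "('s, 'e) edge list set \<Rightarrow> 'c" where
  "end_at a = terminal Y (C0, rep a)"

text \<open>The right action of galleries on classes, computed on a chosen representative;
  \<open>extend_by_cls\<close> shows that the choice does not matter.\<close>

definition extend_by :: "('s, 'e) edge list set \<Rightarrow> ('s, 'e) edge list \<Rightarrow> ('s, 'e) edge list set" where
  "extend_by a es = cls (rep a @ es)"

lemma cls_eq: "homotopic M Y (C0, es) (C0, fs) \<Longrightarrow> cls es = cls fs"
  unfolding cls_def by (intro Collect_cong) (meson homotopic_sym homotopic_trans)

lemma cls_eqD: "cls es = cls fs \<Longrightarrow> gallery_from M Y C0 fs \<Longrightarrow> homotopic M Y (C0, es) (C0, fs)"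
  using homotopic_refl[of "(C0, fs)"] unfolding cls_def by auto

lemma rep_cls:
  assumes "gallery_from M Y C0 es"
  shows "homotopic M Y (C0, es) (C0, rep (cls es))"
proof -
  have "es \<in> cls es" using assms homotopic_refl by (simp add: cls_def)
  then have "rep (cls es) \<in> cls es" unfolding rep_def by (rule someI)
  then show ?thesis by (simp add: cls_def)
qed

lemma rep_class:
  assumes "a \<in> classes"
  shows "gallery_from M Y C0 (rep a)" "cls (rep a) = a"
proof -
  obtain es where es: "gallery_from M Y C0 es" "a = cls es" using assms by (auto simp: classes_def)
  show "gallery_from M Y C0 (rep a)"
    using homotopic_gallery[OF rep_cls[OF es(1)]] unfolding es(2) by simp
  show "cls (rep a) = a" unfolding es(2) by (rule cls_eq[OF rep_cls[OF es(1)], symmetric])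
qed

lemma end_at_chamber: "a \<in> classes \<Longrightarrow> end_at a \<in> chambers Y"
  using gallery_from_terminal[OF rep_class(1)] by (simp add: end_at_def)

lemma cls_class: "gallery_from M Y C0 es \<Longrightarrow> cls es \<in> classes"
  by (auto simp: classes_def)

lemma end_at_cls: "gallery_from M Y C0 es \<Longrightarrow> end_at (cls es) = terminal Y (C0, es)"
  using homotopic_ends[OF rep_cls, of es] unfolding end_at_def by metis

lemma rep_gallery:
  "a \<in> classes \<Longrightarrow> gallery_from M Y (end_at a) es \<Longrightarrow> gallery_from M Y C0 (rep a @ es)"
  using rep_class by (simp add: gallery_from_append[OF cs] end_at_def)

lemma extend_by_class:
  assumes "a \<in> classes" "gallery_from M Y (end_at a) es"
  shows "extend_by a es \<in> classes" "end_at (extend_by a es) = terminal Y (end_at a, es)"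
  using rep_gallery[OF assms] cls_class end_at_cls by (simp_all add: extend_by_def end_at_def)

lemma extend_by_Nil [simp]: "a \<in> classes \<Longrightarrow> extend_by a [] = a"
  using rep_class by (simp add: extend_by_def)

lemma extend_by_cls:
  assumes "gallery_from M Y C0 (es @ fs)"
  shows "extend_by (cls es) fs = cls (es @ fs)"
proof -
  have es: "gallery_from M Y C0 es" "gallery_from M Y (terminal Y (C0, es)) fs"
    using assms by (auto simp: gallery_from_append[OF cs])
  have "homotopic M Y (C0, [] @ es @ fs) (C0, [] @ rep (cls es) @ fs)"
    using rep_cls[OF es(1)] es(2) C0 by (intro homotopic_context) simp_all
  then have "homotopic M Y (C0, es @ fs) (C0, rep (cls es) @ fs)" by simp
  then show ?thesis unfolding extend_by_def by (rule cls_eq[symmetric])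
qed

lemma extend_by_append:
  assumes "a \<in> classes" "gallery_from M Y (end_at a) (es @ fs)"
  shows "extend_by (extend_by a es) fs = extend_by a (es @ fs)"
  using extend_by_cls[of "rep a @ es" fs] rep_gallery[OF assms] by (simp add: extend_by_def)

lemma extend_by_eq:
  assumes "a \<in> classes" "homotopic M Y (end_at a, es) (end_at a, fs)"
  shows "extend_by a es = extend_by a fs"
proof -
  have "homotopic M Y (C0, rep a @ es @ []) (C0, rep a @ fs @ [])"
    using assms(2) rep_class(1)[OF assms(1)]
      gallery_from_terminal[of M Y "end_at a" es] homotopic_gallery[OF assms(2)]
    by (intro homotopic_context) (simp_all add: end_at_def)
  then have "homotopic M Y (C0, rep a @ es) (C0, rep a @ fs)" by simp
  then show ?thesis unfolding extend_by_def by (rule cls_eq)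
qed

text \<open>Freeness of the action: the common prefix \<open>rep a\<close> cancels. This is the
  source of simple connectedness.\<close>

lemma extend_by_eqD:
  assumes "a \<in> classes" "gallery_from M Y (end_at a) fs" "extend_by a es = extend_by a fs"
  shows "homotopic M Y (end_at a, es) (end_at a, fs)"
proof -
  have "homotopic M Y (C0, rep a @ es) (C0, rep a @ fs)"
    using cls_eqD rep_gallery[OF assms(1,2)] assms(3) by (simp add: extend_by_def)
  from homotopic_cancel[OF this] show ?thesis by (simp add: end_at_def)
qed

text \<open>The action groupoid of the panel groupoid of \<open>Y\<close> on the classes: an arrow
  is a class together with an arrow of \<open>Y\<close> at its end, and its target is the result of
  the action.\<close>

definition cover_panel ::
  "'s \<Rightarrow> (('s, 'e) edge list set, ('s, 'e) edge list set \<times> 'e) groupoid" where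
  "cover_panel s =
     \<lparr>verts = classes,
      arrs = {(a, e). a \<in> classes \<and> e \<in> arrs (panel_groupoid Y s) \<and> src (panel_groupoid Y s) e = end_at a},
      src = fst,
      tgt = (\<lambda>g. extend_by (fst g) (arrow_word s (snd g))),
      ident = (\<lambda>a. (a, ident (panel_groupoid Y s) (end_at a))),
      gcomp = (\<lambda>g h. (fst g, gcomp (panel_groupoid Y s) (snd g) (snd h))),
      ginv = (\<lambda>g. (extend_by (fst g) (arrow_word s (snd g)), ginv (panel_groupoid Y s) (snd g)))\<rparr>"

lemma groupoid_cover_panel:
  assumes s: "s \<in> gens M"
  shows "groupoid (cover_panel s)"
proof -
  let ?P = "panel_groupoid Y s"
  interpret P: groupoid ?P by (rule panel(1)[OF s])
  note [simp] = P.src_closed P.tgt_closed P.ident_closed P.src_ident P.tgt_ident P.comp_closed P.src_comp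
    P.tgt_comp P.comp_assoc P.inver_closed P.src_inver P.tgt_inver
    P.comp_inver P.inver_comp panel(2)[OF s] arrow_word_ident[OF s] end_at_chamber
  have step: "extend_by a (arrow_word s e) \<in> classes" "end_at (extend_by a (arrow_word s e)) = tgt ?P e"
    if "a \<in> classes" "e \<in> arrs ?P" "src ?P e = end_at a" for a e
    using arrow_word_gallery[OF s that(2)] extend_by_class[OF that(1)] that(3) by auto
  \<comment> \<open>The action law, which gives the target of a composite arrow.\<close>
  have comp: "extend_by (extend_by a (arrow_word s e)) (arrow_word s f) = extend_by a (arrow_word s (gcomp ?P e f))"
    if "a \<in> classes" "e \<in> arrs ?P" "src ?P e = end_at a" "f \<in> arrs ?P" "src ?P f = tgt ?P e" for a e f
  proof -
    have h: "homotopic M Y (end_at a, arrow_word s e @ arrow_word s f) (end_at a, arrow_word s (gcomp ?P e f))"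
      using arrow_word_comp[OF s that(2,4)] that by simp
    then show ?thesis
      using extend_by_append[OF that(1)] extend_by_eq[OF that(1) h] homotopic_gallery[OF h] by simp
  qed
  have inv: "extend_by (extend_by a (arrow_word s e)) (arrow_word s (ginv ?P e)) = a"
    if "a \<in> classes" "e \<in> arrs ?P" "src ?P e = end_at a" for a e
    using comp[OF that, of "ginv ?P e"] that by simp
  \<comment> \<open>The unit laws are restated for an identity at a chamber merely equal to the
    source or target; in the covering it appears as \<open>end_at a\<close>.\<close>
  have [simp]: "gcomp ?P (ident ?P C) e = e" if "e \<in> arrs ?P" "src ?P e = C" for e C
    using P.ident_comp[OF that(1)] that(2) by simp
  have [simp]: "gcomp ?P e (ident ?P C) = e" if "e \<in> arrs ?P" "tgt ?P e = C" for e C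
    using P.comp_ident[OF that(1)] that(2) by simp
  have "classes \<noteq> {}" using cls_class[of "[]"] C0 by auto
  then show ?thesis
    by unfold_locales (auto simp: cover_panel_def step comp inv)
qed

section \<open>The covering, its projection, and explicit lifts of galleries\<close>

fun lift :: "('s, 'e) edge list set \<Rightarrow> ('s, 'e) edge list \<Rightarrow>
    ('s, ('s, 'e) edge list set \<times> 'e) edge list" where
  "lift a [] = []"
| "lift a (i # es) = (fst i, (a, snd i)) # lift (extend_by a [i]) es"

text \<open>Every lift of a defining suite is declared a defining suite, which builds the covering
  axiom into the construction.\<close>

definition cover :: "('s, ('s, 'e) edge list set, ('s, 'e) edge list set \<times> 'e) weyl_data" where
  "cover =
     \<lparr>chambers = classes, panel_groupoid = cover_panel,
      defining_suites = (\<lambda>s t. {(a, lift a es) | a es. a \<in> classes \<and> (end_at a, es) \<in> defining_suites Y s t})\<rparr>"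

definition proj :: "('s, ('s, 'e) edge list set, ('s, 'e) edge list set \<times> 'e, 'c, 'e) morphism" where
  "proj = \<lparr>on_chambers = end_at, on_edges = (\<lambda>i. (fst i, snd (snd i)))\<rparr>"

lemma chambers_cover [simp]: "chambers cover = classes"
  by (simp add: cover_def)

lemma chamber_system_cover: "chamber_system M cover"
  using groupoid_cover_panel cls_class[of "[]"] C0
  by (auto simp: chamber_system_def cover_def cover_panel_def)

lemma edges_cover:
  "(s, (a, e)) \<in> edges M cover \<longleftrightarrow> a \<in> classes \<and> (s, e) \<in> edges M Y \<and> edge_src Y (s, e) = end_at a"
proof (cases "s \<in> gens M")
  case s: True
  let ?P = "panel_groupoid Y s"
  interpret P: groupoid ?P by (rule panel(1)[OF s])
  \<comment> \<open>Only the identity at the source of \<open>e\<close> can equal \<open>e\<close>;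
    this is the identity that occurs in the arrow of \<open>cover_panel\<close> at
    \<open>a\<close>.\<close>
  have "(\<forall>C\<in>chambers Y. e \<noteq> ident ?P C) \<longleftrightarrow> e \<noteq> ident ?P (end_at a)"
    if "a \<in> classes" "src ?P e = end_at a"
    using that end_at_chamber P.src_ident panel(2)[OF s] by auto
  then show ?thesis
    using s by (auto simp: edges_def cover_def cover_panel_def edge_src_def)
qed (auto simp: edges_def)

lemma edge_cover_ops:
  "edge_src cover (s, (a, e)) = a"
  "edge_inv cover (s, (a, e)) = (s, (extend_by a (arrow_word s e), ginv (panel_groupoid Y s) e))"
  "edge_comp cover (s, (a, e)) (t, (b, f)) = (s, (a, gcomp (panel_groupoid Y s) e f))"
  "(s, e) \<in> edges M Y \<Longrightarrow> edge_tgt cover (s, (a, e)) = extend_by a [(s, e)]"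
  by (simp_all add: edge_src_def edge_tgt_def edge_inv_def edge_comp_def cover_def cover_panel_def
      arrow_word_def)

lemma extend_by_edge:
  assumes "a \<in> classes" "i \<in> edges M Y" "edge_src Y i = end_at a"
  shows "extend_by a [i] \<in> classes" "end_at (extend_by a [i]) = edge_tgt Y i"
  using extend_by_class[OF assms(1), of "[i]"] assms edge_tgt_chambers[OF cs] by auto

lemma proj_morphism: "chamber_system_morphism M cover Y proj"
proof -
  have "on_edges proj i \<in> edges M Y \<and> fst (on_edges proj i) = fst i \<and>
      edge_src Y (on_edges proj i) = on_chambers proj (edge_src cover i) \<and>
      edge_tgt Y (on_edges proj i) = on_chambers proj (edge_tgt cover i) \<and>
      on_edges proj (edge_inv cover i) = edge_inv Y (on_edges proj i)"
    if i: "i \<in> edges M cover" for i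
  proof -
    obtain s a e where ie: "i = (s, (a, e))" by (metis prod.collapse)
    then show ?thesis
      using i extend_by_edge(2)[of a "(s, e)"]
      by (auto simp: proj_def edges_cover edge_cover_ops) (simp_all add: edge_inv_def)
  qed
  moreover have "on_edges proj (edge_comp cover i j) = edge_comp Y (on_edges proj i) (on_edges proj j)" for i j
    by (cases i; cases j) (auto simp: proj_def edge_cover_ops edge_comp_def cover_def cover_panel_def)
  ultimately show ?thesis
    using end_at_chamber by (simp add: chamber_system_morphism_def) (simp add: proj_def)
qed

text \<open>Connectedness of \<open>Y\<close> gives surjectivity: a chamber is the end of the class
  of any gallery reaching it from \<open>C0\<close>.\<close>

lemma proj_etale:
  assumes "connected_system M Y"
  shows "surjective_etale M cover Y proj"
proof -
  have "\<exists>a\<in>classes. D = end_at a" if "D \<in> chambers Y" for D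
  proof -
    obtain \<beta> where "gallery M Y \<beta>" "initial \<beta> = C0" "terminal Y \<beta> = D"
      using assms C0 \<open>D \<in> chambers Y\<close> unfolding connected_system_def by metis
    then have "gallery_from M Y C0 (snd \<beta>)" "terminal Y (C0, snd \<beta>) = D"
      by (auto simp: gallery_def initial_def)
    then show ?thesis
      using cls_class end_at_cls by (intro bexI[of _ "cls (snd \<beta>)"]) simp_all
  qed
  then have "end_at ` classes = chambers Y" using end_at_chamber by auto
  moreover have "bij_betw (on_edges proj) {i \<in> edges M cover. edge_src cover i = a}
      {j \<in> edges M Y. edge_src Y j = end_at a}" if "a \<in> classes" for a
    \<comment> \<open>The inverse tags an edge of \<open>Y\<close> with the class \<open>a\<close>
      from which it issues.\<close>
    by (rule bij_betw_byWitness[where f' = "\<lambda>i. (fst i, (a, snd i))"])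
      (use that in \<open>auto simp: proj_def edges_cover edge_cover_ops\<close>)
  ultimately show ?thesis by (simp add: surjective_etale_def) (simp add: proj_def)
qed

lemma lift_simps [simp]:
  "map fst (lift a es) = map fst es" "map (on_edges proj) (lift a es) = es"
  by (induction es arbitrary: a) (auto simp: proj_def)

lemma lift_gallery:
  "a \<in> classes \<Longrightarrow> gallery_from M Y (end_at a) es \<Longrightarrow>
   gallery_from M cover a (lift a es) \<and> terminal cover (a, lift a es) = extend_by a es"
proof (induction es arbitrary: a)
  case (Cons i es)
  obtain s e where i: "i = (s, e)" by (cases i)
  have *: "extend_by a [i] \<in> classes" "end_at (extend_by a [i]) = edge_tgt Y i"
    using extend_by_edge[OF Cons.prems(1), of i] Cons.prems(2) by auto
  then show ?case
    using Cons.IH[OF *(1)] Cons.prems extend_by_append[of a "[i]" es] i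
    by (auto simp: edges_cover edge_cover_ops)
qed simp

text \<open>The tag of each edge is its source, hence the class reached so far, so a gallery of the
  covering is recovered from its start and its projection.\<close>

lemma gallery_is_lift:
  "gallery_from M cover a fs \<Longrightarrow> a \<in> classes \<and> gallery_from M Y (end_at a) (map (on_edges proj) fs) \<and>
    lift a (map (on_edges proj) fs) = fs"
proof (induction fs arbitrary: a)
  case Nil
  then show ?case using end_at_chamber by simp
next
  case (Cons i fs)
  obtain s b e where i: "i = (s, (b, e))" by (metis prod.collapse)
  with Cons.prems have a: "a \<in> classes" "(s, e) \<in> edges M Y" "edge_src Y (s, e) = end_at a" "b = a"
    by (auto simp: edges_cover edge_cover_ops)
  then have "gallery_from M cover (extend_by a [(s, e)]) fs"
    using Cons.prems i by (simp add: edge_cover_ops)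
  from Cons.IH[OF this] show ?case
    using a i extend_by_edge[OF a(1-3)] by (auto simp: proj_def)
qed

lemma terminal_cover:
  assumes "gallery_from M cover a fs"
  shows "terminal cover (a, fs) = extend_by a (map (on_edges proj) fs)"
  using gallery_is_lift[OF assms] lift_gallery by metis

lemma weyl_data_cover: "weyl_data M cover"
  unfolding weyl_data_def
proof (intro conjI allI impI ballI)
  fix s t \<beta> assume st: "spherical_pair M s t" and "\<beta> \<in> defining_suites cover s t"
  then obtain a es where \<beta>: "\<beta> = (a, lift a es)" and a: "a \<in> classes"
    and es: "(end_at a, es) \<in> defining_suites Y s t" by (auto simp: cover_def)
  \<comment> \<open>The lift closes up because a null-homotopic cycle acts trivially.\<close>
  have "extend_by a es = a"
    using extend_by_eq[OF a defining_suite_homotopic[OF st es]] a by simp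
  moreover have "gtype (end_at a, es) = alternating (2 * the_enat (mat M s t)) s t"
    using X st es by (auto simp: weyl_data_def st_cycle_def)
  ultimately show "st_cycle M cover s t \<beta>"
    using lift_gallery[OF a suite_cycle(1)[OF st es]] \<beta>
    by (simp add: st_cycle_def initial_def gtype_def)
qed (rule chamber_system_cover)

lemma covering_proj:
  assumes "connected_system M Y"
  shows "covering M cover Y proj"
proof -
  interpret cover: weyl M cover by unfold_locales (rule weyl_data_cover)
  have "suite M Y (image_gallery proj \<beta>)"
    if "spherical_pair M s t" "\<beta> \<in> defining_suites cover s t" for s t \<beta>
  proof (rule defining_suite_suite[OF that(1)])
    show "image_gallery proj \<beta> \<in> defining_suites Y s t"
      using that(2) by (auto simp: cover_def image_gallery_def) (simp add: proj_def)
  qed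
  moreover have "suite M cover \<beta>"
    if "spherical_pair M s t" "gallery M cover \<beta>" "image_gallery proj \<beta> \<in> defining_suites Y s t" for s t \<beta>
  proof (rule cover.defining_suite_suite[OF that(1)])
    obtain a fs where \<beta>: "\<beta> = (a, fs)" by (cases \<beta>)
    then have "a \<in> classes" "lift a (map (on_edges proj) fs) = fs"
      using gallery_is_lift[of a fs] that(2) by auto
    moreover have "(end_at a, map (on_edges proj) fs) \<in> defining_suites Y s t"
      using that(3) \<beta> by (simp add: image_gallery_def) (simp add: proj_def)
    ultimately show "\<beta> \<in> defining_suites cover s t"
      unfolding \<beta> cover_def
      by (intro CollectI exI[of _ a] exI[of _ "map (on_edges proj) fs"] | simp)+
  qed
  ultimately show ?thesis
    using X weyl_data_cover proj_morphism proj_etale[OF assms]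
    unfolding covering_def weyl_data_morphism_def by blast
qed

lemma connected_cover: "connected_system M cover"
  unfolding connected_system_def
proof (intro ballI)
  fix a b assume "a \<in> chambers cover" "b \<in> chambers cover"
  then have a: "a \<in> classes" and b: "b \<in> classes" by simp_all
  \<comment> \<open>The path from \<open>a\<close> to \<open>b\<close> runs back to
    \<open>C0\<close> along an inverse \<open>rs\<close> of \<open>rep a\<close>, then along
    \<open>rep b\<close>.\<close>
  obtain rs where rs: "gallery_from M Y C0 (rep a @ rs)" "homotopic M Y (C0, rep a @ rs) (C0, [])"
    using inverse_gallery_exists rep_class(1)[OF a] by blast
  have t: "terminal Y (C0, rep a @ rs) = C0" using homotopic_ends[OF rs(2)] by simp
  have "homotopic M Y (C0, [] @ (rep a @ rs) @ rep b) (C0, [] @ [] @ rep b)"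
    using rs t rep_class(1)[OF b] C0 by (intro homotopic_context) auto
  then have h: "homotopic M Y (C0, rep a @ rs @ rep b) (C0, rep b)" by simp
  have "gallery_from M Y (end_at a) (rs @ rep b)"
    using homotopic_gallery[OF h] by (simp add: gallery_from_append[OF cs] end_at_def)
  moreover have "extend_by a (rs @ rep b) = b"
    using cls_eq[OF h] rep_class(2)[OF b] by (simp add: extend_by_def)
  ultimately show "\<exists>\<beta>. gallery M cover \<beta> \<and> initial \<beta> = a \<and> terminal cover \<beta> = b"
    using lift_gallery[OF a] by (intro exI[of _ "(a, lift a (rs @ rep b))"]) (simp add: initial_def)
qed

text \<open>Ends in the covering are values of the action, so equal ends make the projections
  homotopic by freeness; the covering property then lifts the homotopy.\<close>

lemma homotopic_cover:
  assumes "connected_system M Y" "gallery_from M cover a es" "gallery_from M cover a fs"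
    "terminal cover (a, es) = terminal cover (a, fs)"
  shows "homotopic M cover (a, es) (a, fs)"
proof -
  interpret weyl_covering M cover Y proj
    using covering_proj[OF assms(1)] by unfold_locales
  have "homotopic M Y (end_at a, map (on_edges proj) es) (end_at a, map (on_edges proj) fs)"
    using assms(2-4) gallery_is_lift[OF assms(3)]
    by (intro extend_by_eqD) (simp_all add: terminal_cover)
  then show ?thesis
    using assms by (intro homotopic_lift) (simp_all add: proj_def)
qed

end

section \<open>Simple connectedness of the universal cover, and the two claims\<close>

lemma universal_cover_simply_connected:
  assumes u: "universal_cover M X Y p" and conn: "connected_system M Y"
  shows "simply_connected M X"
proof -
  interpret p: weyl_covering M X Y p
    using u by unfold_locales (simp add: universal_cover_def connected_covering_def)
  obtain C0 where "C0 \<in> chambers Y" using p.Y.cs by (auto simp: chamber_system_def)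
  then interpret c: path_cover M Y C0 by unfold_locales
  interpret q: weyl_covering M c.cover Y c.proj
    using c.covering_proj[OF conn] by unfold_locales
  \<comment> \<open>Classes of edge lists have other types than the competitors in the definition of
    \<open>universal_cover\<close>, so the property in arbitrary types is invoked.\<close>
  have "factors_through M X p c.cover c.proj"
    using u q.covering c.connected_cover
    by (intro universal_cover_factors) (simp_all add: connected_covering_def)
  then obtain \<mu> where \<mu>: "chamber_system_morphism M X c.cover \<mu>"
    and pc: "\<And>C. C \<in> chambers X \<Longrightarrow> on_chambers p C = on_chambers c.proj (on_chambers \<mu> C)"
    and pe: "\<And>i. i \<in> edges M X \<Longrightarrow> on_edges p i = on_edges c.proj (on_edges \<mu> i)"
    by (auto simp: factors_through_def weyl_data_morphism_def)
  have image: "image_gallery c.proj (image_gallery \<mu> (C, es)) = (on_chambers p C, map (on_edges p) es)"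
    if "gallery_from M X C es" for C es
    using gallery_from_edges[OF that] gallery_from_initial[OF p.X.cs that] pc pe
    by (auto simp: image_gallery_def)
  show ?thesis
  proof (rule p.X.simply_connectedI)
    fix C es fs
    assume *: "gallery_from M X C es" "gallery_from M X C fs" "terminal X (C, es) = terminal X (C, fs)"
    \<comment> \<open>The morphism \<open>\<mu>\<close> preserves equality of ends, and in the class
      covering this alone implies homotopy.\<close>
    have "homotopic M c.cover (image_gallery \<mu> (C, es)) (image_gallery \<mu> (C, fs))"
      using * morphism_gallery_from[OF \<mu>] morphism_terminal[OF \<mu>, of "(C, es)"] morphism_terminal[OF \<mu>, of "(C, fs)"]
      by (auto simp: image_gallery_def intro!: c.homotopic_cover[OF conn])
    from q.homotopic_image[OF this] show "homotopic M X (C, es) (C, fs)"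
      using * by (intro p.homotopic_lift) (simp_all add: image)
  qed
qed

theorem corollary5p9p1:
  fixes M :: "'s coxeter"
    and W :: "('s, 'c, 'e) weyl_data"
    and Wt :: "('s, 'ct, 'et) weyl_data"
    and p :: "('s, 'ct, 'et, 'c, 'e) morphism"
    and X :: "('s, 'd, 'f) weyl_data"
    and \<Delta> :: "('s, 'g, 'h) weyl_data"
    and q :: "('s, 'g, 'h, 'd, 'f) morphism"
  assumes "coxeter_matrix M"
  shows "(weyl_graph M W \<and> connected_system M W \<and> universal_cover M Wt W p \<longrightarrow> building M Wt) \<and>
         (covering M \<Delta> X q \<and> building M \<Delta> \<longrightarrow> weyl_graph M X \<and> connected_system M X)"
proof (intro conjI impI; elim conjE)
  assume W: "weyl_graph M W" "connected_system M W" and u: "universal_cover M Wt W p"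
  then interpret weyl_covering M Wt W p
    by unfold_locales (simp add: universal_cover_def connected_covering_def)
  show "building M Wt"
    using weyl_graph_lift[OF W(1)] universal_cover_simply_connected[OF u W(2)] u
    by (simp add: building_def universal_cover_def connected_covering_def)
next
  assume q: "covering M \<Delta> X q" and \<Delta>: "building M \<Delta>"
  interpret weyl_covering M \<Delta> X q by unfold_locales (rule q)
  show "weyl_graph M X" "connected_system M X"
    using \<Delta> weyl_graph_image connected_image by (simp_all add: building_def)
qed

end
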